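(* For any integer $n\geq 1$, the continuous edge chromatic number of the Schreier graph $F(2^{\mathbb{Z}^n})$ (with respect to the standard generating set of $\mathbb{Z}^n$) is $\chi'_c(F(2^{\mathbb{Z}^n}))=2n+1$.
   Context: The standard generating set of $\mathbb{Z}^n$ is $\{\pm e_i: 1\leq i\leq n\}$, where $e_i$ has $i$-th coordinate $1$ and all other coordinates $0$. Bernoulli shift: $2^{\mathbb{Z}^n}=\{0,1\}^{\mathbb{Z}^n}$ has the product topology, and $\mathbb{Z}^n$ acts on it by $(g\cdot x)(h)=x(h+g)$. The free part is $F(2^{\mathbb{Z}^n})=\{x\in 2^{\mathbb{Z}^n}: g\cdot x\neq x \text{ for all } g\neq \bar 0\}$, with the subspace topology. The same symbol $F(2^{\mathbb{Z}^n})$ denotes the Schreier graph on this vertex set: $x,y$ are joined by an edge iff $y=\pm e_i\cdot x$ for some $i$ and some choice of sign. A proper edge $\kappa$-coloring of a graph $G$ is a map $c:E(G)\to\kappa$ such that distinct edges sharing a vertex receive distinct values. An edge coloring $c$ of $F(2^{\mathbb{Z}^n})$ with values in a discrete set $\kappa$ is continuous if for each generator $s=\pm e_i$ the map $x\mapsto c(x,s\cdot x)$ is continuous on $F(2^{\mathbb{Z}^n})$. $\chi'_c$ is the least cardinality of a (discrete) set $\kappa$ for which a continuous proper edge $\kappa$-coloring exists. *)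

theory Defs
  imports "HOL-Analysis.Analysis" "HOL-Library.Extended_Nat"
begin

text \<open>
  The group \<open>\<int>\<^sup>n\<close> is the type \<open>int ^ 'n\<close> with \<open>n = CARD('n)\<close>; finite types are nonempty, so
  \<open>n \<ge> 1\<close>. The space \<open>2 ^ (\<int>\<^sup>n)\<close> is the type \<open>int ^ 'n \<Rightarrow> bool\<close>, whose library topology is the
  product of the discrete topologies on \<open>bool\<close>.
\<close>

definition std_generators :: "(int ^ 'n::finite) set" where
  "std_generators = range (\<lambda>i. axis i 1) \<union> range (\<lambda>i. - axis i 1)"

definition shift :: "int ^ 'n \<Rightarrow> (int ^ 'n \<Rightarrow> bool) \<Rightarrow> (int ^ 'n \<Rightarrow> bool)" where
  "shift g x = (\<lambda>h. x (h + g))"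

definition free_part :: "(int ^ 'n \<Rightarrow> bool) set" where
  "free_part = {x. \<forall>g. g \<noteq> 0 \<longrightarrow> shift g x \<noteq> x}"

definition schreier_edges ::
    "(int ^ 'n \<Rightarrow> bool) set \<Rightarrow> (int ^ 'n) set \<Rightarrow> (int ^ 'n \<Rightarrow> bool) set set" where
  "schreier_edges X S = {{x, y} |x y. x \<in> X \<and> y \<in> X \<and> (\<exists>s\<in>S. y = shift s x)}"

definition proper_edge_coloring :: "'v set set \<Rightarrow> 'c set \<Rightarrow> ('v set \<Rightarrow> 'c) \<Rightarrow> bool" where
  "proper_edge_coloring E K c \<longleftrightarrow>
     c ` E \<subseteq> K \<and> (\<forall>e\<in>E. \<forall>f\<in>E. e \<noteq> f \<and> e \<inter> f \<noteq> {} \<longrightarrow> c e \<noteq> c f)"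

definition continuous_edge_coloring ::
    "(int ^ 'n \<Rightarrow> bool) set \<Rightarrow> (int ^ 'n) set \<Rightarrow> 'c set \<Rightarrow> ((int ^ 'n \<Rightarrow> bool) set \<Rightarrow> 'c) \<Rightarrow> bool"
  where
  "continuous_edge_coloring X S K c \<longleftrightarrow>
     (\<forall>s\<in>S. continuous_map (top_of_set X) (discrete_topology K) (\<lambda>x. c {x, shift s x}))"

text \<open>
  Up to renaming colors, a finite color set is a finite set of natural numbers. The value is
  \<open>\<infinity>\<close> (the infimum of the empty set) if no finite color set suffices, so infinite cardinals
  are not told apart; otherwise the infimum is attained.
\<close>

definition continuous_edge_chromatic_number ::
    "(int ^ 'n \<Rightarrow> bool) set \<Rightarrow> (int ^ 'n) set \<Rightarrow> enat" where
  "continuous_edge_chromatic_number X S =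
     Inf {enat (card K) |K :: nat set. finite K \<and>
       (\<exists>c. proper_edge_coloring (schreier_edges X S) K c \<and> continuous_edge_coloring X S K c)}"

end

theory Submission
  imports Defs
begin

text \<open>
  For the upper bound, every line in direction \<open>i\<close> gets marked edges that hit each half-line and
  that form, over all directions together, a matching. Marked edges get color \<open>0\<close>; the remaining
  edges in direction \<open>i\<close> alternate between two private colors, starting afresh at each marked edge.
  The marks are a continuous maximal independent set in \<open>free_part \<times> 'n\<close>: two marks in the same
  direction conflict when they are close or lie on the same line at moderate distance, two marks in
  different directions conflict when they are adjacent. A count shows that conflicts cannot block a
  long segment of a line, so maximality puts a mark on it.

  For the lower bound, with \<open>2n\<close> colors each vertex sees every color, so a color class is a
  continuous perfect matching. Toeplitz points of period \<open>3 ^ j\<close> accumulate, uniformly over their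
  translates, only at free points. By compactness the matching extends to the translates of one of
  them and yields a perfect matching of \<open>(\<int> / 3 ^ j)\<^sup>n\<close>, which has an odd number of vertices.
\<close>

section \<open>Continuity through finite windows\<close>

text \<open>Continuity on the subspace \<open>X\<close> with discrete values. The window may depend
  on the point, so no uniform bound on its size is implied.\<close>

definition locally_determined :: "('i \<Rightarrow> bool) set \<Rightarrow> (('i \<Rightarrow> bool) \<Rightarrow> 'b) \<Rightarrow> bool" where
  "locally_determined X f \<longleftrightarrow>
     (\<forall>x\<in>X. \<exists>W. finite W \<and> (\<forall>y\<in>X. (\<forall>h\<in>W. y h = x h) \<longrightarrow> f y = f x))"

lemma locally_determinedD:
  assumes "locally_determined X f" "x \<in> X"
  shows "\<exists>W. finite W \<and> (\<forall>y\<in>X. (\<forall>h\<in>W. y h = x h) \<longrightarrow> f y = f x)"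
  using assms unfolding locally_determined_def by blast

lemma open_coordinate: "open {y :: 'i \<Rightarrow> bool. y h = b}"
proof -
  have "open ((\<lambda>y :: 'i \<Rightarrow> bool. y h) -` {b})"
    by (intro open_vimage continuous_on_product_coordinates) (simp add: open_discrete)
  then show ?thesis by (simp add: vimage_def)
qed

lemma open_cylinder:
  assumes "finite W"
  shows "open {y :: 'i \<Rightarrow> bool. \<forall>h\<in>W. y h = x h}"
proof -
  have "{y :: 'i \<Rightarrow> bool. \<forall>h\<in>W. y h = x h} = (\<Inter>h\<in>W. {y. y h = x h})" by auto
  then show ?thesis using assms by (simp add: open_INT open_coordinate)
qed

lemma open_contains_cylinder:
  assumes "open (U :: ('i \<Rightarrow> bool) set)" "x \<in> U"
  shows "\<exists>W. finite W \<and> {y. \<forall>h\<in>W. y h = x h} \<subseteq> U"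
proof -
  from assms have "openin (product_topology (\<lambda>_. euclidean) UNIV) U" by (simp add: open_fun_def)
  from product_topology_open_contains_basis[OF this assms(2)] obtain X where
    X: "x \<in> (\<Pi>\<^sub>E i\<in>UNIV. X i)" "finite {i. X i \<noteq> topspace (euclidean :: bool topology)}"
       "(\<Pi>\<^sub>E i\<in>UNIV. X i) \<subseteq> U"
    by blast
  have "y \<in> U" if "\<forall>h\<in>{i. X i \<noteq> UNIV}. y h = x h" for y
  proof -
    have "y i \<in> X i" for i using that X(1) by (cases "X i = UNIV") auto
    then show ?thesis using X(3) by auto
  qed
  then show ?thesis using X(2) by (intro exI[of _ "{i. X i \<noteq> UNIV}"]) auto
qed

text \<open>Cylinders over finite windows form a base of the product topology, so a window at
  \<open>x\<close> amounts to a neighbourhood on which \<open>f\<close> is constant.\<close>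

lemma continuous_map_discrete_iff_locally_determined:
  "continuous_map (top_of_set X) (discrete_topology K) f \<longleftrightarrow> f ` X \<subseteq> K \<and> locally_determined X f"
proof
  assume f: "continuous_map (top_of_set X) (discrete_topology K) f"
  then have im: "f ` X \<subseteq> K" by (auto simp: continuous_map_def)
  moreover have "locally_determined X f"
    unfolding locally_determined_def
  proof
    fix x assume x: "x \<in> X"
    have "openin (top_of_set X) {y \<in> X. f y \<in> {f x}}"
      using openin_continuous_map_preimage[OF f, of "{f x}"] im x by auto
    then obtain U where "open U" and U: "{y \<in> X. f y \<in> {f x}} = X \<inter> U"
      by (auto simp: openin_open)
    moreover have "x \<in> U" using U x by auto
    ultimately obtain W where "finite W" "{y. \<forall>h\<in>W. y h = x h} \<subseteq> U"
      using open_contains_cylinder[of U x] by blast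
    moreover have "f y = f x" if "y \<in> X" "y \<in> U" for y using U that by blast
    ultimately show "\<exists>W. finite W \<and> (\<forall>y\<in>X. (\<forall>h\<in>W. y h = x h) \<longrightarrow> f y = f x)"
      by blast
  qed
  ultimately show "f ` X \<subseteq> K \<and> locally_determined X f" ..
next
  assume f: "f ` X \<subseteq> K \<and> locally_determined X f"
  have "openin (top_of_set X) {x \<in> X. f x \<in> V}" for V
    unfolding openin_subopen[of _ "{x \<in> X. f x \<in> V}"]
  proof
    fix x assume x: "x \<in> {x \<in> X. f x \<in> V}"
    then obtain W where W: "finite W" "\<forall>y\<in>X. (\<forall>h\<in>W. y h = x h) \<longrightarrow> f y = f x"
      using locally_determinedD[OF conjunct2[OF f], of x] by blast
    show "\<exists>T. openin (top_of_set X) T \<and> x \<in> T \<and> T \<subseteq> {x \<in> X. f x \<in> V}"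
    proof (intro exI conjI)
      show "openin (top_of_set X) (X \<inter> {y. \<forall>h\<in>W. y h = x h})"
        using open_cylinder[OF W(1)] by (rule openin_open_Int)
      show "X \<inter> {y. \<forall>h\<in>W. y h = x h} \<subseteq> {x \<in> X. f x \<in> V}"
      proof
        fix y assume y: "y \<in> X \<inter> {y. \<forall>h\<in>W. y h = x h}"
        then have "f y = f x" using W(2) by blast
        then show "y \<in> {x \<in> X. f x \<in> V}" using x y by simp
      qed
    qed (use x in simp)
  qed
  then show "continuous_map (top_of_set X) (discrete_topology K) f"
    using f by (auto simp: continuous_map_def)
qed

section \<open>Closure properties of finite-window dependence\<close>

lemma locally_determined_const: "locally_determined X (\<lambda>_. c)"
  unfolding locally_determined_def by auto

lemma locally_determined_app2:
  assumes "locally_determined X f" "locally_determined X g"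
  shows "locally_determined X (\<lambda>x. H (f x) (g x))"
  unfolding locally_determined_def
proof
  fix x assume x: "x \<in> X"
  obtain W where W: "finite W" "\<forall>y\<in>X. (\<forall>h\<in>W. y h = x h) \<longrightarrow> f y = f x"
    using locally_determinedD[OF assms(1) x] by blast
  obtain W' where W': "finite W'" "\<forall>y\<in>X. (\<forall>h\<in>W'. y h = x h) \<longrightarrow> g y = g x"
    using locally_determinedD[OF assms(2) x] by blast
  have *: "H (f y) (g y) = H (f x) (g x)" if "y \<in> X" "\<forall>h\<in>W \<union> W'. y h = x h" for y
  proof -
    have "f y = f x" "g y = g x" using W(2) W'(2) that by blast+
    then show ?thesis by simp
  qed
  show "\<exists>W. finite W \<and> (\<forall>y\<in>X. (\<forall>h\<in>W. y h = x h) \<longrightarrow> H (f y) (g y) = H (f x) (g x))"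
    by (intro exI[of _ "W \<union> W'"] conjI ballI impI finite_UnI W(1) W'(1)) (rule *)
qed

lemma locally_determined_not:
  "locally_determined X P \<Longrightarrow> locally_determined X (\<lambda>x. \<not> P x)"
  by (rule locally_determined_app2[of X P "\<lambda>_. True" "\<lambda>a _. \<not> a", OF _ locally_determined_const])

lemma locally_determined_ball:
  assumes "finite I" "\<And>i. i \<in> I \<Longrightarrow> locally_determined X (P i)"
  shows "locally_determined X (\<lambda>x. \<forall>i\<in>I. P i x)"
  using assms
proof (induction I rule: finite_induct)
  case empty
  then show ?case by (simp add: locally_determined_const)
next
  case (insert a I)
  have "locally_determined X (\<lambda>x. P a x \<and> (\<forall>i\<in>I. P i x))"
    by (intro locally_determined_app2[where H = "(\<and>)"] insert) auto
  then show ?case by simp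
qed

text \<open>The least index may be unbounded over \<open>X\<close>, but at a given \<open>x\<close>
  it is settled by the finitely many truth values \<open>P j x\<close> with \<open>j\<close> up to
  that index.\<close>

lemma locally_determined_Least:
  fixes P :: "nat \<Rightarrow> ('i \<Rightarrow> bool) \<Rightarrow> bool"
  assumes P: "\<And>k. locally_determined X (P k)" and ex: "\<And>x. x \<in> X \<Longrightarrow> \<exists>k. P k x"
  shows "locally_determined X (\<lambda>x. LEAST k. P k x)"
  unfolding locally_determined_def
proof
  fix x assume x: "x \<in> X"
  define k where "k = (LEAST k. P k x)"
  have "locally_determined X (\<lambda>y. \<forall>j\<in>{..k}. P j y = P j x)"
  proof (rule locally_determined_ball)
    show "locally_determined X (\<lambda>y. P j y = P j x)" for j
      by (rule locally_determined_app2[OF P locally_determined_const, where H = "(=)"])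
  qed simp
  from locally_determinedD[OF this x]
  obtain W where W: "finite W" "\<forall>y\<in>X. (\<forall>h\<in>W. y h = x h) \<longrightarrow>
      (\<forall>j\<in>{..k}. P j y = P j x) = (\<forall>j\<in>{..k}. P j x = P j x)"
    by blast
  have "(LEAST k. P k y) = k" if "y \<in> X" "\<forall>h\<in>W. y h = x h" for y
  proof (rule Least_equality)
    have *: "P j y = P j x" if "j \<le> k" for j
      using W(2)[rule_format, OF \<open>y \<in> X\<close>] \<open>\<forall>h\<in>W. y h = x h\<close> that by blast
    have "P k x" unfolding k_def by (rule LeastI_ex[OF ex[OF x]])
    then show "P k y" using *[of k] by blast
    show "k \<le> j" if "P j y" for j
    proof (rule ccontr)
      assume "\<not> k \<le> j"
      then have "j < k" by simp
      then show False
        using *[of j] that not_less_Least[of j "\<lambda>k. P k x"] unfolding k_def by linarith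
    qed
  qed
  then show "\<exists>W. finite W \<and> (\<forall>y\<in>X. (\<forall>h\<in>W. y h = x h) \<longrightarrow>
      (LEAST k. P k y) = (LEAST k. P k x))"
    using W(1) unfolding k_def by blast
qed

section \<open>The shift action\<close>

lemma shift_shift [simp]: "shift g (shift h x) = shift (g + h) x"
  by (simp add: shift_def fun_eq_iff ac_simps)

lemma shift_zero [simp]: "shift 0 x = x"
  by (simp add: shift_def)

lemma shift_in_free_part [simp]: "shift g x \<in> free_part \<longleftrightarrow> x \<in> free_part"
proof -
  have *: "shift g x \<in> free_part" if "x \<in> free_part" for g and x :: "int ^ 'n \<Rightarrow> bool"
    unfolding free_part_def
  proof (clarsimp)
    fix h :: "int ^ 'n" assume h: "h \<noteq> 0" "shift (h + g) x = shift g x"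
    have "shift (- g) (shift (h + g) x) = shift (- g) (shift g x)" by (simp only: h(2))
    then have "shift h x = x" by simp
    then show False using h(1) that by (auto simp: free_part_def)
  qed
  from *[of x g] *[of "shift g x" "- g"] show ?thesis by auto
qed

lemma shift_eq_iff:
  assumes "x \<in> free_part"
  shows "shift g x = shift h x \<longleftrightarrow> g = h"
proof
  assume "shift g x = shift h x"
  then have "shift (- h) (shift g x) = shift (- h) (shift h x)" by (simp only:)
  then have "shift (g - h) x = x" by (simp add: algebra_simps)
  then have "g - h = 0" using assms unfolding free_part_def by blast
  then show "g = h" by simp
qed simp

lemma axis_add: "axis i a + axis i b = (axis i (a + b) :: int ^ 'n)"
  by (simp add: vec_eq_iff axis_def)

lemma axis_uminus: "- axis i a = (axis i (- a) :: int ^ 'n)"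
  by (simp add: vec_eq_iff axis_def)

lemma locally_determined_shift:
  assumes "locally_determined free_part P"
  shows "locally_determined free_part (\<lambda>x. P (shift g x))"
  unfolding locally_determined_def
proof
  fix x :: "int ^ 'a \<Rightarrow> bool" assume "x \<in> free_part"
  then obtain W where W: "finite W"
      "\<And>y. y \<in> free_part \<Longrightarrow> \<forall>h\<in>W. y h = shift g x h \<Longrightarrow> P y = P (shift g x)"
    using locally_determinedD[OF assms, of "shift g x"] shift_in_free_part[of g x] by blast
  show "\<exists>W. finite W \<and> (\<forall>y\<in>free_part. (\<forall>h\<in>W. y h = x h) \<longrightarrow> P (shift g y) = P (shift g x))"
  proof (intro exI[of _ "(\<lambda>h. h + g) ` W"] conjI ballI impI)
    fix y :: "int ^ 'a \<Rightarrow> bool"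
    assume "y \<in> free_part" "\<forall>h\<in>(\<lambda>h. h + g) ` W. y h = x h"
    moreover have "shift g y \<in> free_part" using calculation(1) by simp
    moreover have "\<forall>h\<in>W. shift g y h = shift g x h" using calculation(2) by (simp add: shift_def)
    ultimately show "P (shift g y) = P (shift g x)" using W(2) by blast
  qed (use W(1) in simp)
qed

section \<open>Continuous maximal independent sets\<close>

text \<open>Every \<open>g\<close> in \<open>C i\<close> is nonzero and so changes a free
  \<open>x\<close> somewhere. Recording \<open>x\<close> at finitely many such places gives a
  cylinder disjoint from its translates by \<open>C i\<close>. Cylinders are countable in number, so
  a sequence of them suffices.\<close>

lemma countable_separated_cover:
  fixes C :: "'d::countable \<Rightarrow> (int ^ 'n) set"
  assumes "\<And>i. finite (C i)" "\<And>i. 0 \<notin> C i"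
  shows "\<exists>(V :: nat \<Rightarrow> (int ^ 'n \<Rightarrow> bool) set) (d :: nat \<Rightarrow> 'd).
    (\<forall>m. locally_determined free_part (\<lambda>x. x \<in> V m)) \<and>
    (\<forall>m. \<forall>x\<in>V m. \<forall>g\<in>C (d m). shift g x \<notin> V m) \<and>
    (\<forall>x\<in>free_part. \<forall>i. \<exists>m. x \<in> V m \<and> d m = i)"
proof -
  define cyl :: "((int ^ 'n) \<times> bool) list \<Rightarrow> (int ^ 'n \<Rightarrow> bool) set" where
    "cyl l = {y. \<forall>(h, b)\<in>set l. y h = b}" for l
  define sep where "sep i U \<longleftrightarrow> (\<forall>x\<in>U. \<forall>g\<in>C i. shift g x \<notin> U)" for i and U :: "(int ^ 'n \<Rightarrow> bool) set"
  \<comment> \<open>\<open>from_nat\<close> reaches every pair of a cylinder specification and an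
    index; specifications that are not separated become the empty set in \<open>V\<close>.\<close>
  define D where "D m = (from_nat m :: ((int ^ 'n) \<times> bool) list \<times> 'd)" for m
  define V where "V m = (if sep (snd (D m)) (cyl (fst (D m))) then cyl (fst (D m)) else {})" for m
  show ?thesis
  proof (intro exI[of _ V] exI[of _ "\<lambda>m. snd (D m)"] conjI allI ballI)
    have "locally_determined free_part (\<lambda>x. x \<in> cyl l)" for l
      unfolding locally_determined_def
    proof (intro ballI exI[of _ "fst ` set l"] conjI impI)
      fix x y :: "int ^ 'n \<Rightarrow> bool"
      assume "\<forall>h\<in>fst ` set l. y h = x h"
      then have "y (fst p) = x (fst p)" if "p \<in> set l" for p using that by blast
      then show "(y \<in> cyl l) = (x \<in> cyl l)"
        unfolding cyl_def case_prod_unfold mem_Collect_eq by (intro ball_cong) simp_all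
    qed simp
    then show "locally_determined free_part (\<lambda>x. x \<in> V m)" for m
      by (simp add: V_def locally_determined_const)
    show "shift g x \<notin> V m" if "x \<in> V m" "g \<in> C (snd (D m))" for m x g
      using that by (auto simp: V_def sep_def split: if_splits)
    fix x :: "int ^ 'n \<Rightarrow> bool" and i assume x: "x \<in> free_part"
    \<comment> \<open>A place where translation by \<open>g\<close> alters \<open>x\<close>. Fixing
      the values of \<open>x\<close> there and at the place \<open>g\<close> further on excludes
      \<open>shift g z\<close> from the cylinder for each \<open>z\<close> in it.\<close>
    define w where "w g = (SOME h. x (h + g) \<noteq> x h)" for g
    have w: "x (w g + g) \<noteq> x (w g)" if "g \<in> C i" for g
    proof -
      have "g \<noteq> 0" using that assms(2) by metis
      with x have "shift g x \<noteq> x" by (simp add: free_part_def)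
      then have "\<exists>h. x (h + g) \<noteq> x h" unfolding shift_def fun_eq_iff by blast
      then show ?thesis unfolding w_def by (rule someI_ex)
    qed
    have "finite ((\<lambda>h. (h, x h)) ` (w ` C i \<union> (\<lambda>g. w g + g) ` C i))" using assms(1) by simp
    from finite_list[OF this]
    obtain l where l: "set l = (\<lambda>h. (h, x h)) ` (w ` C i \<union> (\<lambda>g. w g + g) ` C i)" ..
    have y: "y (w g) = x (w g) \<and> y (w g + g) = x (w g + g)" if "y \<in> cyl l" "g \<in> C i" for y g
      using that unfolding cyl_def l by simp
    have "sep i (cyl l)"
      unfolding sep_def
    proof (intro ballI notI)
      fix z g assume z: "z \<in> cyl l" "g \<in> C i" "shift g z \<in> cyl l"
      then have "shift g z (w g) = x (w g)" "z (w g + g) = x (w g + g)" using y by blast+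
      then show False using w[OF z(2)] by (simp add: shift_def)
    qed
    moreover have "x \<in> cyl l" unfolding cyl_def l by auto
    ultimately show "\<exists>m. x \<in> V m \<and> snd (D m) = i"
      by (intro exI[of _ "to_nat (l, i)"]) (simp add: V_def D_def)
  qed
qed

text \<open>\<open>C\<close> encodes a conflict graph on pairs of a point and an index:
  \<open>(x, i)\<close> and \<open>(shift g x, j)\<close> conflict for \<open>g\<close> in
  \<open>C i j\<close>. A greedy choice runs along the separated cover: stage \<open>m\<close>
  admits the candidates in \<open>V m\<close> that conflict with nothing chosen before. Candidates
  of one stage do not conflict with each other, and every candidate gets its turn, so the union is
  independent and maximal.\<close>

lemma continuous_maximal_independent:
  fixes C :: "'d::finite \<Rightarrow> 'd \<Rightarrow> (int ^ 'n) set"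
  assumes fin: "\<And>i j. finite (C i j)" and irrefl: "\<And>i. 0 \<notin> C i i"
    and sym: "\<And>i j g. g \<in> C i j \<Longrightarrow> - g \<in> C j i"
  shows "\<exists>A :: 'd \<Rightarrow> (int ^ 'n \<Rightarrow> bool) set.
    (\<forall>i. locally_determined free_part (\<lambda>x. x \<in> A i)) \<and>
    (\<forall>i j. \<forall>x\<in>A i. \<forall>g\<in>C i j. shift g x \<notin> A j) \<and>
    (\<forall>x\<in>free_part. \<forall>i. x \<notin> A i \<longrightarrow> (\<exists>j. \<exists>g\<in>C i j. shift g x \<in> A j))"
proof -
  from countable_separated_cover[of "\<lambda>i. C i i", OF fin irrefl]
  obtain V :: "nat \<Rightarrow> (int ^ 'n \<Rightarrow> bool) set" and d :: "nat \<Rightarrow> 'd" where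
    V: "\<forall>m. locally_determined free_part (\<lambda>x. x \<in> V m)"
    "\<forall>m. \<forall>x\<in>V m. \<forall>g\<in>C (d m) (d m). shift g x \<notin> V m"
    "\<forall>x\<in>free_part. \<forall>i. \<exists>m. x \<in> V m \<and> d m = i"
    by blast
  define G where "G = rec_nat (\<lambda>_. {}) (\<lambda>m G i. G i \<union>
      {x \<in> V m. d m = i \<and> (\<forall>j. \<forall>g\<in>C i j. shift g x \<notin> G j)})"
  have G_Suc: "G (Suc m) i = G m i \<union> {x \<in> V m. d m = i \<and> (\<forall>j. \<forall>g\<in>C i j. shift g x \<notin> G m j)}"
    for m i by (simp add: G_def)
  have G_mono: "G m i \<subseteq> G m' i" if "m \<le> m'" for m m' i
  proof (rule lift_Suc_mono_le[of "\<lambda>m. G m i", OF _ that])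
    show "G n i \<subseteq> G (Suc n) i" for n unfolding G_Suc by blast
  qed
  have loc: "locally_determined free_part (\<lambda>x. x \<in> G m i)" for m i
  proof (induction m arbitrary: i)
    case 0
    then show ?case by (simp add: G_def locally_determined_const)
  next
    case (Suc m)
    have "locally_determined free_part (\<lambda>x. \<forall>j\<in>UNIV. \<forall>g\<in>C i j. shift g x \<notin> G m j)"
    proof (intro locally_determined_ball fin finite locally_determined_not)
      show "locally_determined free_part (\<lambda>x. shift g x \<in> G m j)" for g j
        by (rule locally_determined_shift[OF Suc])
    qed
    from locally_determined_app2[OF V(1)[rule_format, of m] this, of "\<lambda>a b. a \<and> d m = i \<and> b"]
    have "locally_determined free_part
        (\<lambda>x. x \<in> V m \<and> d m = i \<and> (\<forall>j\<in>UNIV. \<forall>g\<in>C i j. shift g x \<notin> G m j))" .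
    from locally_determined_app2[OF Suc[of i] this, of "(\<or>)"]
    show ?case by (simp add: G_Suc)
  qed
  have indep: "shift g x \<notin> G m j" if "x \<in> G m i" "g \<in> C i j" for m i j x g
    using that
  proof (induction m arbitrary: i j x g)
    case 0
    then show ?case by (simp add: G_def)
  next
    case (Suc m)
    show ?case
    proof
      assume gx: "shift g x \<in> G (Suc m) j"
      \<comment> \<open>Cases by entry time: both points old, only \<open>x\<close> old, only
        \<open>shift g x\<close> old, both new in stage \<open>m\<close>. The second needs
        \<open>sym\<close>, the last that \<open>V m\<close> is separated.\<close>
      consider "x \<in> G m i" "shift g x \<in> G m j"
        | "x \<in> G m i" "\<forall>g'\<in>C j i. shift g' (shift g x) \<notin> G m i"
        | "shift g x \<in> G m j" "\<forall>g'\<in>C i j. shift g' x \<notin> G m j"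
        | "x \<in> V m" "shift g x \<in> V m" "d m = i" "d m = j"
        using gx Suc.prems(1) unfolding G_Suc by blast
      then show False
      proof cases
        case 1
        then show ?thesis using Suc.IH Suc.prems(2) by blast
      next
        case 2
        then have "shift (- g) (shift g x) \<notin> G m i" using sym[OF Suc.prems(2)] by blast
        then show ?thesis using 2(1) by simp
      next
        case 3
        then show ?thesis using Suc.prems(2) by blast
      next
        case 4
        then have "shift g x \<notin> V m" using V(2) Suc.prems(2) by simp
        then show ?thesis using 4(2) by simp
      qed
    qed
  qed
  define A where "A i = (\<Union>m. G m i)" for i
  have A_indep: "shift g x \<notin> A j" if x: "x \<in> A i" and g: "g \<in> C i j" for x g i j
  proof
    assume "shift g x \<in> A j"
    then obtain m m' where "x \<in> G m i" "shift g x \<in> G m' j" using x by (auto simp: A_def)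
    then have "x \<in> G (max m m') i" "shift g x \<in> G (max m m') j"
      using G_mono[of m "max m m'" i] G_mono[of m' "max m m'" j] by auto
    then show False using indep[OF _ g] by simp
  qed
  have A_max: "\<exists>j. \<exists>g\<in>C i j. shift g x \<in> A j" if x: "x \<in> free_part" "x \<notin> A i" for x i
  proof -
    obtain m where m: "x \<in> V m" "d m = i" using V(3) x(1) by blast
    have "x \<notin> G (Suc m) i" using x(2) unfolding A_def by blast
    then obtain j g where "g \<in> C i j" "shift g x \<in> G m j" using m by (auto simp: G_Suc)
    then show ?thesis by (auto simp: A_def)
  qed
  have in_A: "\<exists>W. finite W \<and> (\<forall>y\<in>free_part. (\<forall>h\<in>W. y h = x h) \<longrightarrow> shift g y \<in> A i)"
    if x: "x \<in> free_part" "shift g x \<in> A i" for x g i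
  proof -
    obtain m where m: "shift g x \<in> G m i" using x(2) by (auto simp: A_def)
    from locally_determinedD[OF locally_determined_shift[OF loc] x(1), of g m i]
    obtain W where "finite W" "\<forall>y\<in>free_part. (\<forall>h\<in>W. y h = x h) \<longrightarrow>
        (shift g y \<in> G m i) = (shift g x \<in> G m i)" by blast
    then show ?thesis using m unfolding A_def by blast
  qed
  have A_loc: "locally_determined free_part (\<lambda>x. x \<in> A i)" for i
    unfolding locally_determined_def
  proof
    fix x :: "int ^ 'n \<Rightarrow> bool" assume x: "x \<in> free_part"
    show "\<exists>W. finite W \<and> (\<forall>y\<in>free_part. (\<forall>h\<in>W. y h = x h) \<longrightarrow> (y \<in> A i) = (x \<in> A i))"
    proof (cases "x \<in> A i")
      case True
      then show ?thesis using in_A[OF x, of 0] by simp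
    next
      \<comment> \<open>By maximality a point outside \<open>A i\<close> sees a conflicting mark.
        That mark persists for all points agreeing on a finite window, and independence keeps them
        all out of \<open>A i\<close>; so the complement is open too.\<close>
      case False
      then obtain j g where g: "g \<in> C i j" "shift g x \<in> A j" using A_max x by blast
      obtain W where W: "finite W" "\<forall>y\<in>free_part. (\<forall>h\<in>W. y h = x h) \<longrightarrow> shift g y \<in> A j"
        using in_A[OF x g(2)] by blast
      then have "\<forall>y\<in>free_part. (\<forall>h\<in>W. y h = x h) \<longrightarrow> y \<notin> A i"
        using A_indep[OF _ g(1)] by blast
      then show ?thesis using False W(1) by auto
    qed
  qed
  show ?thesis
  proof (intro exI[of _ A] conjI allI ballI impI)
    show "locally_determined free_part (\<lambda>x. x \<in> A i)" for i by (rule A_loc)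
    show "shift g x \<notin> A j" if "x \<in> A i" "g \<in> C i j" for i j x g by (rule A_indep[OF that])
    show "\<exists>j. \<exists>g\<in>C i j. shift g x \<in> A j" if "x \<in> free_part" "x \<notin> A i" for x i
      by (rule A_max[OF that])
  qed
qed

section \<open>Sparse markers on every line\<close>

definition box :: "int \<Rightarrow> (int ^ 'n) set" where
  "box R = {g. \<forall>i. \<bar>g $ i\<bar> \<le> R}"

lemma finite_box: "finite (box R :: (int ^ 'n) set)"
proof (rule finite_subset)
  show "box R \<subseteq> vec_lambda ` (UNIV \<rightarrow>\<^sub>E {- R..R} :: ('n \<Rightarrow> int) set)"
  proof
    fix g :: "int ^ 'n" assume g: "g \<in> box R"
    have "- R \<le> g $ i \<and> g $ i \<le> R" for i
      using g[unfolded box_def, simplified, rule_format, of i] by linarith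
    then have "vec_nth g \<in> UNIV \<rightarrow>\<^sub>E {- R..R}" by auto
    then show "g \<in> vec_lambda ` (UNIV \<rightarrow>\<^sub>E {- R..R})" by (intro image_eqI[of _ _ "vec_nth g"]) simp_all
  qed
  show "finite (vec_lambda ` (UNIV \<rightarrow>\<^sub>E {- R..R} :: ('n \<Rightarrow> int) set))"
    by (intro finite_imageI finite_PiE) auto
qed

lemma uminus_in_box: "- g \<in> box R \<longleftrightarrow> g \<in> box R"
  by (simp add: box_def)

lemma axis_in_box: "\<bar>t\<bar> \<le> R \<Longrightarrow> axis i t \<in> box R"
  by (auto simp: box_def axis_def)

text \<open>If the segment from \<open>- r\<close> to \<open>2 * r\<close> has no mark, each of the
  \<open>r\<close> positions in \<open>{0..<r}\<close> has a blocker. Blockers of direction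
  \<open>i\<close> use at most \<open>P\<close> offsets, each at most once; the margins of length
  \<open>r\<close> make sure that they do not lie on the line itself. Blockers of other directions
  use at most \<open>M\<close> pairs of direction and offset, each at most once in each of
  \<open>P + 1\<close> blocks of length \<open>M + 1\<close>. The total
  \<open>P + M * (P + 1)\<close> is one less than \<open>r\<close>.\<close>

lemma markers_hit_lines:
  fixes A :: "'n::finite \<Rightarrow> (int ^ 'n \<Rightarrow> bool) set" and M P :: nat
  defines "M \<equiv> CARD('n) * card (box 1 :: (int ^ 'n) set)"
  defines "P \<equiv> card (box (int M) :: (int ^ 'n) set)"
  assumes r: "r = (int M + 1) * (int P + 1)"
  assumes C: "\<And>i j. C i j = (if i = j then (box (int M) \<union> axis i ` {- r..r}) - {0} else box 1)"
  assumes indep: "\<And>i j x g. x \<in> A i \<Longrightarrow> g \<in> C i j \<Longrightarrow> shift g x \<notin> A j"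
  assumes maximal: "\<And>i x. x \<in> free_part \<Longrightarrow> x \<notin> A i \<Longrightarrow> \<exists>j. \<exists>g\<in>C i j. shift g x \<in> A j"
  assumes x: "x \<in> free_part"
  shows "\<exists>t\<in>{- r..2 * r}. shift (axis i t) x \<in> A i"
proof (rule ccontr)
  assume "\<not> ?thesis"
  then have none: "shift (axis i t) x \<notin> A i" if "- r \<le> t" "t \<le> 2 * r" for t
    using that by auto
  define p where "p t = (SOME p. snd p \<in> C i (fst p) \<and> shift (snd p + axis i t) x \<in> A (fst p))" for t
  have p: "snd (p t) \<in> C i (fst (p t)) \<and> shift (snd (p t) + axis i t) x \<in> A (fst (p t))"
    if t: "t \<in> {0..<r}" for t
  proof -
    have "shift (axis i t) x \<notin> A i" using none[of t] t by simp
    then obtain j g where "g \<in> C i j" "shift g (shift (axis i t) x) \<in> A j"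
      using maximal[of "shift (axis i t) x" i] x by auto
    then have "\<exists>p. snd p \<in> C i (fst p) \<and> shift (snd p + axis i t) x \<in> A (fst p)"
      by (intro exI[of _ "(j, g)"]) simp
    then show ?thesis unfolding p_def by (rule someI_ex)
  qed
  \<comment> \<open>Marks of the same direction at the same offset from positions \<open>t\<close>
    and \<open>t'\<close> differ by \<open>axis i (t' - t)\<close>, so this vector cannot be a
    conflict.\<close>
  have separated: "axis i (t' - t) \<notin> C j j"
    if "shift (g + axis i t) x \<in> A j" "shift (g + axis i t') x \<in> A j" for g j t t'
  proof
    assume "axis i (t' - t) \<in> C j j"
    from indep[OF that(1) this] have "shift (axis i (t' - t) + (g + axis i t)) x \<notin> A j" by simp
    moreover have "axis i (t' - t) + (g + axis i t) = g + (axis i (t' - t) + axis i t)"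
      by (simp only: ac_simps)
    ultimately show False using that(2) by (simp only: axis_add) simp
  qed
  \<comment> \<open>Records who blocks position \<open>t\<close>. Marks of direction \<open>i\<close> at the same offset would lie on a common
      line at distance less than \<open>r\<close>; other blockers need the block number of \<open>t\<close> as well, since
      they are only known to be \<open>M\<close>-separated.\<close>
  define code where "code t = (if fst (p t) = i then Inl (snd (p t))
      else Inr (fst (p t), snd (p t), t div (int M + 1)))" for t
  have "inj_on code {0..<r}"
  proof (rule inj_onI)
    fix t t' assume t: "t \<in> {0..<r}" "t' \<in> {0..<r}" and eq: "code t = code t'"
    have same: "fst (p t') = fst (p t)" "snd (p t') = snd (p t)"
      using eq by (auto simp: code_def split: if_splits)
    have notin: "axis i (t' - t) \<notin> C (fst (p t)) (fst (p t))"
      using separated[of "snd (p t)" t "fst (p t)" t'] p[OF t(1)] p[OF t(2)]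
      unfolding same by blast
    show "t = t'"
    proof (rule ccontr)
      assume "t \<noteq> t'"
      then have nz: "axis i (t' - t) \<noteq> 0" by (simp add: axis_eq_0_iff)
      show False
      proof (cases "fst (p t) = i")
        case True
        have "axis i (t' - t) \<in> axis i ` {- r..r}" using t by auto
        then show False using notin nz True by (simp add: C)
      next
        case False
        then have same_div: "t div (int M + 1) = t' div (int M + 1)"
          using eq same by (auto simp: code_def split: if_splits)
        have "(int M + 1) * (t' div (int M + 1)) + t mod (int M + 1) = t"
          using mult_div_mod_eq[of "int M + 1" t] unfolding same_div .
        with mult_div_mod_eq[of "int M + 1" t'] have "\<bar>t' - t\<bar> \<le> int M"
          using pos_mod_bound[of "int M + 1" t] pos_mod_bound[of "int M + 1" t']
            pos_mod_sign[of "int M + 1" t] pos_mod_sign[of "int M + 1" t']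
          by linarith
        then show False using notin nz by (simp add: C axis_in_box)
      qed
    qed
  qed
  moreover have "code ` {0..<r} \<subseteq> Inl ` box (int M) \<union> Inr ` (UNIV \<times> box 1 \<times> {0..<int P + 1})"
  proof
    fix c assume "c \<in> code ` {0..<r}"
    then obtain t where t: "t \<in> {0..<r}" and c: "c = code t" by auto
    have g: "snd (p t) \<in> C i (fst (p t))" "shift (snd (p t) + axis i t) x \<in> A (fst (p t))"
      using p[OF t] by blast+
    show "c \<in> Inl ` box (int M) \<union> Inr ` (UNIV \<times> box 1 \<times> {0..<int P + 1})"
    proof (cases "fst (p t) = i")
      case True
      have "snd (p t) \<notin> axis i ` {- r..r}"
      proof
        assume "snd (p t) \<in> axis i ` {- r..r}"
        then obtain s where s: "- r \<le> s" "s \<le> r" "snd (p t) = axis i s" by auto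
        then have "shift (axis i (s + t)) x \<in> A i" using g(2) True by (simp add: axis_add)
        then show False using none[of "s + t"] s(1,2) t by simp
      qed
      then show ?thesis using g(1) True by (simp add: c code_def C)
    next
      case False
      have "t div (int M + 1) < int P + 1"
      proof (rule ccontr)
        assume "\<not> t div (int M + 1) < int P + 1"
        then have "(int M + 1) * (int P + 1) \<le> (int M + 1) * (t div (int M + 1))"
          by (intro mult_left_mono) auto
        also have "\<dots> \<le> t" using mult_div_mod_eq[of "int M + 1" t] pos_mod_sign[of "int M + 1" t] by linarith
        finally show False using t by (simp add: r)
      qed
      moreover have "0 \<le> t div (int M + 1)" using t by (simp add: pos_imp_zdiv_nonneg_iff)
      ultimately show ?thesis using g(1) False by (auto simp: c code_def C)
    qed
  qed
  ultimately have "card {0..<r} \<le> card (Inl ` box (int M) \<union> Inr ` (UNIV \<times> box 1 \<times> {0..<int P + 1})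
      :: ((int ^ 'n) + 'n \<times> (int ^ 'n) \<times> int) set)"
    by (intro card_inj_on_le) (auto simp: finite_box)
  also have "\<dots> \<le> card (Inl ` box (int M) :: ((int ^ 'n) + 'n \<times> (int ^ 'n) \<times> int) set) +
      card (Inr ` (UNIV \<times> box 1 \<times> {0..<int P + 1}) :: ((int ^ 'n) + 'n \<times> (int ^ 'n) \<times> int) set)"
    by (rule card_Un_le)
  also have "\<dots> = P + M * (P + 1)"
  proof -
    have "nat (1 + int P) = Suc P" by simp
    then show ?thesis by (simp add: card_image card_cartesian_product P_def[symmetric] add.commute)
        (simp add: M_def algebra_simps)
  qed
  finally have "nat r \<le> P + M * (P + 1)" by simp
  moreover have "nat r = (M + 1) * (P + 1)" unfolding r by (simp add: nat_mult_distrib nat_add_distrib)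
  ultimately show False by (simp add: algebra_simps)
qed

text \<open>Base points of touching edges in different directions differ by an element of
  \<open>box 1\<close>, so the third clause makes marked edges of different directions disjoint. The
  last clause finds marks at or behind \<open>x\<close>, the side from which the coloring
  counts.\<close>

lemma line_markers:
  "\<exists>A :: 'n::finite \<Rightarrow> (int ^ 'n \<Rightarrow> bool) set.
    (\<forall>i. locally_determined free_part (\<lambda>x. x \<in> A i)) \<and>
    (\<forall>i. \<forall>x\<in>A i. shift (axis i 1) x \<notin> A i) \<and>
    (\<forall>i j. \<forall>x\<in>A i. \<forall>g\<in>box 1. i \<noteq> j \<longrightarrow> shift g x \<notin> A j) \<and>
    (\<forall>x\<in>free_part. \<forall>i. \<exists>k. shift (axis i (- int k)) x \<in> A i)"
proof -
  \<comment> \<open>\<open>M\<close> depends on the dimension only, \<open>P\<close> on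
    \<open>M\<close>, and \<open>r\<close> on both, so the choice is not circular: the conflicts of
    length \<open>r\<close> along the line add no blockers to the count.\<close>
  define M where "M = CARD('n) * card (box 1 :: (int ^ 'n) set)"
  define P where "P = card (box (int M) :: (int ^ 'n) set)"
  define r where "r = (int M + 1) * (int P + 1)"
  define C :: "'n \<Rightarrow> 'n \<Rightarrow> (int ^ 'n) set" where
    "C i j = (if i = j then (box (int M) \<union> axis i ` {- r..r}) - {0} else box 1)" for i j
  have r1: "1 \<le> r" unfolding r_def by (simp add: algebra_simps)
  have C_fin: "finite (C i j)" for i j by (simp add: C_def finite_box)
  have C_irrefl: "0 \<notin> C i i" for i by (simp add: C_def)
  have C_sym: "- g \<in> C j i" if "g \<in> C i j" for g i j
  proof -
    have "- g \<in> axis i ` {- r..r}" if "g \<in> axis i ` {- r..r}"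
    proof -
      from that obtain s where "- r \<le> s" "s \<le> r" "g = axis i s" by auto
      then show ?thesis by (intro image_eqI[of _ _ "- s"]) (auto simp: axis_uminus)
    qed
    then show ?thesis using that by (auto simp: C_def uminus_in_box split: if_splits)
  qed
  have "\<exists>A :: 'n \<Rightarrow> (int ^ 'n \<Rightarrow> bool) set.
      (\<forall>i. locally_determined free_part (\<lambda>x. x \<in> A i)) \<and>
      (\<forall>i j. \<forall>x\<in>A i. \<forall>g\<in>C i j. shift g x \<notin> A j) \<and>
      (\<forall>x\<in>free_part. \<forall>i. x \<notin> A i \<longrightarrow> (\<exists>j. \<exists>g\<in>C i j. shift g x \<in> A j))"
    by (rule continuous_maximal_independent) (fact C_fin C_irrefl C_sym)+
  then obtain A :: "'n \<Rightarrow> (int ^ 'n \<Rightarrow> bool) set" where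
    loc: "\<forall>i. locally_determined free_part (\<lambda>x. x \<in> A i)" and
    indep: "\<forall>i j. \<forall>x\<in>A i. \<forall>g\<in>C i j. shift g x \<notin> A j" and
    maximal: "\<forall>x\<in>free_part. \<forall>i. x \<notin> A i \<longrightarrow> (\<exists>j. \<exists>g\<in>C i j. shift g x \<in> A j)"
    by (elim exE conjE)
  have hit: "\<exists>k. shift (axis i (- int k)) x \<in> A i" if x: "x \<in> free_part" for x i
  proof -
    \<comment> \<open>Starting \<open>2 * r\<close> steps back turns the window from
      \<open>- r\<close> to \<open>2 * r\<close> into one from \<open>- 3 * r\<close> to
      \<open>0\<close>.\<close>
    have "\<exists>t\<in>{- r..2 * r}. shift (axis i t) (shift (axis i (- 2 * r)) x) \<in> A i"
    proof (rule markers_hit_lines[where A = A and C = C and r = r])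
      show "C i j = (if i = j then
          box (int (CARD('n) * card (box 1 :: (int ^ 'n) set))) \<union> axis i ` {- r..r} - {0}
          else box 1)" for i j
        by (simp add: C_def M_def)
      show "shift (axis i (- 2 * r)) x \<in> free_part" using x by simp
      show "shift g y \<notin> A k" if "y \<in> A j" "g \<in> C j k" for j k y g using indep that by blast
      show "\<exists>k. \<exists>g\<in>C j k. shift g y \<in> A k" if "y \<in> free_part" "y \<notin> A j" for j y
        using maximal that by blast
    qed (simp add: r_def P_def M_def)
    then obtain t where "t \<le> 2 * r" "shift (axis i t + axis i (- 2 * r)) x \<in> A i" by auto
    then have "shift (axis i (- int (nat (2 * r - t)))) x \<in> A i" by (simp add: axis_add)
    then show ?thesis by blast
  qed
  show ?thesis
  proof (intro exI[of _ A] conjI allI ballI impI)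
    show "shift (axis i 1) x \<notin> A i" if "x \<in> A i" for i x
    proof -
      have "axis i 1 \<in> C i i" using r1 by (auto simp: C_def axis_eq_0_iff)
      then show ?thesis using indep that by blast
    qed
    show "shift g x \<notin> A j" if "x \<in> A i" "g \<in> box 1" "i \<noteq> j" for i j x g
    proof -
      have "g \<in> C i j" using that by (simp add: C_def)
      then show ?thesis using indep that(1) by blast
    qed
  qed (use loc hit in blast)+
qed

section \<open>A coloring with one extra color\<close>

lemma locally_determined_cong:
  assumes "locally_determined X f" "\<And>x. x \<in> X \<Longrightarrow> g x = f x"
  shows "locally_determined X g"
  unfolding locally_determined_def
proof
  fix x assume x: "x \<in> X"
  obtain W where W: "finite W" "\<forall>y\<in>X. (\<forall>h\<in>W. y h = x h) \<longrightarrow> f y = f x"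
    using locally_determinedD[OF assms(1) x] by blast
  have "g y = g x" if y: "y \<in> X" "\<forall>h\<in>W. y h = x h" for y
  proof -
    have "f y = f x" using W(2) y by blast
    then show ?thesis using assms(2)[OF x] assms(2)[OF y(1)] by (simp only:)
  qed
  then show "\<exists>W. finite W \<and> (\<forall>y\<in>X. (\<forall>h\<in>W. y h = x h) \<longrightarrow> g y = g x)"
    using W(1) by blast
qed

section \<open>Edges in positive orientation\<close>

lemma schreier_edge_iff:
  "E \<in> schreier_edges free_part std_generators \<longleftrightarrow>
     (\<exists>x\<in>free_part. \<exists>i. E = {x, shift (axis i 1) x})"
proof
  assume "E \<in> schreier_edges free_part std_generators"
  then obtain x s where x: "x \<in> free_part" and E: "E = {x, shift s x}" and s: "s \<in> std_generators"
    unfolding schreier_edges_def by blast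
  from s consider i where "s = axis i 1" | i where "s = - axis i 1"
    by (auto simp: std_generators_def)
  then show "\<exists>x\<in>free_part. \<exists>i. E = {x, shift (axis i 1) x}"
  proof cases
    case 1
    then show ?thesis using x E by blast
  next
    case 2
    then have "E = {shift s x, shift (axis i 1) (shift s x)}" using E by (simp add: insert_commute)
    moreover have "shift s x \<in> free_part" using x by simp
    ultimately show ?thesis by blast
  qed
next
  assume "\<exists>x\<in>free_part. \<exists>i. E = {x, shift (axis i 1) x}"
  then obtain x i where x: "x \<in> free_part" and E: "E = {x, shift (axis i 1) x}" by blast
  moreover have "shift (axis i 1) x \<in> free_part" using x by simp
  moreover have "axis i 1 \<in> std_generators" by (simp add: std_generators_def)
  ultimately show "E \<in> schreier_edges free_part std_generators"
    unfolding schreier_edges_def by blast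
qed

text \<open>Matching the endpoints crosswise would, by freeness, make a sum of two positive unit
  vectors vanish. Hence an edge has a unique base point and direction, and colors can be assigned to
  these.\<close>

lemma schreier_edge_unique:
  assumes x: "x \<in> free_part" and eq: "{x, shift (axis i 1) x} = {y, shift (axis j 1) y}"
  shows "x = y \<and> i = j"
proof -
  from eq consider "x = y" "shift (axis i 1) x = shift (axis j 1) y"
    | "x = shift (axis j 1) y" "shift (axis i 1) x = y"
    by (auto simp: doubleton_eq_iff)
  then show ?thesis
  proof cases
    case 1
    then have "axis i (1 :: int) = axis j 1" using shift_eq_iff[OF x] by blast
    then show ?thesis using 1(1) by (simp add: axis_eq_axis)
  next
    case 2
    have "shift (axis j 1) (shift (axis i 1) x) = x" unfolding 2(2) by (rule 2(1)[symmetric])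
    then have "shift (axis j 1 + axis i 1) x = shift 0 x" by simp
    then have "axis j 1 + axis i 1 = (0 :: int ^ 'a)" using shift_eq_iff[OF x] by blast
    then have "(axis j 1 + axis i 1 :: int ^ 'a) $ i = 0" by simp
    then show ?thesis by (auto simp: axis_def split: if_splits)
  qed
qed

text \<open>An unmarked edge is colored by the parity of its distance back to the last mark. The
  edge just before a mark may have either parity, because the mark itself has color
  \<open>0\<close>; so gaps of any length are harmless.\<close>

lemma edge_coloring_exists:
  "\<exists>c. proper_edge_coloring (schreier_edges (free_part :: (int ^ 'n::finite \<Rightarrow> bool) set)
         std_generators) {..2 * CARD('n)} c \<and>
       continuous_edge_coloring (free_part :: (int ^ 'n \<Rightarrow> bool) set)
         std_generators {..2 * CARD('n)} c"
proof -
  from line_markers obtain A :: "'n \<Rightarrow> (int ^ 'n \<Rightarrow> bool) set" where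
    A_loc: "\<forall>i. locally_determined free_part (\<lambda>x. x \<in> A i)" and
    A_step: "\<forall>i. \<forall>x\<in>A i. shift (axis i 1) x \<notin> A i" and
    A_disj: "\<forall>i j. \<forall>x\<in>A i. \<forall>g\<in>box 1. i \<noteq> j \<longrightarrow> shift g x \<notin> A j" and
    A_hit: "\<forall>x\<in>free_part. \<forall>i. \<exists>k. shift (axis i (- int k)) x \<in> A i"
    by (elim exE conjE)
  obtain e :: "'n \<Rightarrow> nat" where e: "bij_betw e UNIV {0..<CARD('n)}"
    using ex_bij_betw_finite_nat[OF finite_class.finite_UNIV] by blast
  have e_less: "e i < CARD('n)" for i using bij_betwE[OF e] by auto
  have e_inj: "e i = e j \<Longrightarrow> i = j" for i j using e by (auto simp: bij_betw_def inj_on_def)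
  define dist where "dist i x = (LEAST k. shift (axis i (- int k)) x \<in> A i)" for i x
  \<comment> \<open>Direction \<open>i\<close> owns the colors \<open>2 * e i + 1\<close> and
    \<open>2 * e i + 2\<close>, which stay within \<open>2 * CARD('n)\<close> because
    \<open>e i\<close> is less than \<open>CARD('n)\<close>.\<close>
  define col where "col i x = (if x \<in> A i then 0 else 2 * e i + 1 + dist i x mod 2)" for i x
  define c where "c E = (THE v. \<exists>x i. x \<in> free_part \<and> E = {x, shift (axis i 1) x} \<and> v = col i x)" for E
  have c_eq: "c {x, shift (axis i 1) x} = col i x" if "x \<in> free_part" for x i
    unfolding c_def
  proof (rule the_equality)
    show "\<exists>y j. y \<in> free_part \<and> {x, shift (axis i 1) x} = {y, shift (axis j 1) y} \<and> col i x = col j y"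
      using that by (intro exI[of _ x] exI[of _ i]) simp
    show "v = col i x"
      if v: "\<exists>y j. y \<in> free_part \<and> {x, shift (axis i 1) x} = {y, shift (axis j 1) y} \<and> v = col j y" for v
    proof -
      from v obtain y j where
        y: "y \<in> free_part \<and> {x, shift (axis i 1) x} = {y, shift (axis j 1) y} \<and> v = col j y"
        by (elim exE)
      then have "x = y \<and> i = j" by (intro schreier_edge_unique[OF \<open>x \<in> free_part\<close>]) simp
      then show ?thesis using y by simp
    qed
  qed
  have col_le: "col i x \<le> 2 * CARD('n)" for i x
    using e_less[of i] mod_less_divisor[of 2 "dist i x"] unfolding col_def by auto
  have col_dir: "i = j \<or> (x \<in> A i \<and> y \<in> A j)" if "col i x = col j y" for i j x y
  proof (cases "x \<in> A i \<or> y \<in> A j")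
    case True
    then show ?thesis using that by (auto simp: col_def split: if_splits)
  next
    case False
    then have "2 * e i + dist i x mod 2 = 2 * e j + dist j y mod 2" using that by (simp add: col_def)
    then have "(2 * e i + dist i x mod 2) div 2 = (2 * e j + dist j y mod 2) div 2" by simp
    then have "e i = e j" by simp
    then show ?thesis using e_inj by blast
  qed
  \<comment> \<open>One step forward either reaches a mark, and then \<open>x\<close> is unmarked,
    or raises the distance to the last mark by exactly one.\<close>
  have col_step: "col i (shift (axis i 1) x) \<noteq> col i x" if x: "x \<in> free_part" for i x
  proof (cases "shift (axis i 1) x \<in> A i")
    case True
    then have "x \<notin> A i" using A_step by blast
    then show ?thesis using True by (simp add: col_def)
  next
    case False
    obtain k where k: "shift (axis i (- int k)) (shift (axis i 1) x) \<in> A i"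
      using A_hit shift_in_free_part x by blast
    have "dist i (shift (axis i 1) x) =
        Suc (LEAST k. shift (axis i (- int (Suc k))) (shift (axis i 1) x) \<in> A i)"
      unfolding dist_def
    proof (rule Least_Suc[of "\<lambda>k. shift (axis i (- int k)) (shift (axis i 1) x) \<in> A i", OF k])
      show "shift (axis i (- int 0)) (shift (axis i 1) x) \<notin> A i" using False by (simp add: axis_add)
    qed
    also have "\<dots> = Suc (dist i x)" by (simp add: dist_def axis_add)
    finally have "dist i (shift (axis i 1) x) = Suc (dist i x)" .
    then have "dist i (shift (axis i 1) x) mod 2 \<noteq> dist i x mod 2" by presburger
    then show ?thesis using False by (simp add: col_def)
  qed
  have "proper_edge_coloring (schreier_edges free_part std_generators) {..2 * CARD('n)} c"
    unfolding proper_edge_coloring_def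
  proof (intro conjI ballI impI)
    show "c ` schreier_edges free_part std_generators \<subseteq> {..2 * CARD('n)}"
    proof
      fix v assume "v \<in> c ` schreier_edges free_part std_generators"
      then obtain E where E: "E \<in> schreier_edges free_part std_generators" and v: "v = c E" by blast
      from E[unfolded schreier_edge_iff] obtain x i where "x \<in> free_part" "E = {x, shift (axis i 1) x}"
        by (elim bexE exE)
      then have "x \<in> free_part" "v = c {x, shift (axis i 1) x}" using v by simp_all
      then show "v \<in> {..2 * CARD('n)}" using col_le c_eq by simp
    qed
  next
    fix E E' :: "(int ^ 'n \<Rightarrow> bool) set"
    assume edges: "E \<in> schreier_edges free_part std_generators" "E' \<in> schreier_edges free_part std_generators"
    from edges(1)[unfolded schreier_edge_iff]
    obtain x i where x: "x \<in> free_part" and E: "E = {x, shift (axis i 1) x}" by (elim bexE exE)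
    from edges(2)[unfolded schreier_edge_iff]
    obtain y j where y: "y \<in> free_part" and E': "E' = {y, shift (axis j 1) y}" by (elim bexE exE)
    assume EE: "E \<noteq> E' \<and> E \<inter> E' \<noteq> {}"
    then obtain z where z: "z \<in> E" "z \<in> E'" by blast
    \<comment> \<open>\<open>a\<close> and \<open>b\<close> lead from the base points to the common
      vertex, so the base points differ by \<open>a - b\<close>. For equal directions this is
      \<open>0\<close> or one step along the line; for different directions it lies in
      \<open>box 1\<close>.\<close>
    have "\<exists>a\<in>{0, axis i 1}. z = shift a x" using z(1) unfolding E by simp
    moreover have "\<exists>b\<in>{0, axis j 1}. z = shift b y" using z(2) unfolding E' by simp
    ultimately obtain a b where a: "a \<in> {0, axis i 1}" and b: "b \<in> {0, axis j 1}"
      and ab: "shift a x = shift b y" by blast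
    have y_eq: "y = shift (a - b) x"
    proof -
      have "shift (- b) (shift b y) = shift (- b) (shift a x)" by (simp only: ab)
      then show ?thesis by simp
    qed
    show "c E \<noteq> c E'"
    proof
      assume "c E = c E'"
      then have eq: "col i x = col j y" unfolding E E' by (simp only: c_eq x y)
      show False
      proof (cases "i = j")
        case True
        consider "a = b" | "a = axis i 1" "b = 0" | "a = 0" "b = axis i 1"
          using a b True by blast
        then show False
        proof cases
          case 1
          then show False using y_eq EE True unfolding E E' by simp
        next
          case 2
          then show False using y_eq eq True col_step[OF x, of i] by simp
        next
          case 3
          then have "x = shift (axis i 1) y" using y_eq by simp
          then show False using eq True col_step[OF y, of i] by simp
        qed
      next
        case False
        then have "x \<in> A i" "y \<in> A j" using col_dir[OF eq] by blast+
        moreover have "a - b \<in> box 1" using a b False by (auto simp: box_def axis_def)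
        ultimately show False using A_disj False unfolding y_eq by blast
      qed
    qed
  qed
  moreover have "continuous_edge_coloring free_part std_generators {..2 * CARD('n)} c"
    unfolding continuous_edge_coloring_def continuous_map_discrete_iff_locally_determined
  proof
    fix s :: "int ^ 'n" assume s: "s \<in> std_generators"
    have dist_loc: "locally_determined free_part (dist i)" for i
      unfolding dist_def
    proof (rule locally_determined_Least)
      show "locally_determined free_part (\<lambda>x. shift (axis i (- int k)) x \<in> A i)" for k
        by (rule locally_determined_shift[OF A_loc[rule_format]])
      show "\<exists>k. shift (axis i (- int k)) x \<in> A i" if "x \<in> free_part" for x
        using A_hit that by blast
    qed
    have col_loc: "locally_determined free_part (col i)" for i
      unfolding col_def
      by (rule locally_determined_app2[OF A_loc[rule_format, of i] dist_loc[of i],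
            where H = "\<lambda>a k. if a then 0 else 2 * e i + 1 + k mod 2"])
    \<comment> \<open>For a negative generator \<open>s\<close> the edge is based at
      \<open>shift s x\<close>; this is where the translation \<open>g\<close> comes from.\<close>
    have "\<exists>g i. \<forall>x\<in>free_part. c {x, shift s x} = col i (shift g x)"
    proof -
      from s consider i where "s = axis i 1" | i where "s = - axis i 1"
        by (auto simp: std_generators_def)
      then show ?thesis
      proof cases
        case 1
        then show ?thesis using c_eq by (intro exI[of _ 0] exI[of _ i]) simp
      next
        case 2
        have "c {x, shift s x} = col i (shift s x)" if "x \<in> free_part" for x
          using c_eq[of "shift s x" i] that 2 by (simp add: insert_commute)
        then show ?thesis by blast
      qed
    qed
    then obtain g i where gi: "\<forall>x\<in>free_part. c {x, shift s x} = col i (shift g x)" by blast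
    have "locally_determined free_part (\<lambda>x. c {x, shift s x})"
      using locally_determined_shift[OF col_loc] by (rule locally_determined_cong) (rule gi[rule_format])
    then show "(\<lambda>x. c {x, shift s x}) ` free_part \<subseteq> {..2 * CARD('n)} \<and>
        locally_determined free_part (\<lambda>x. c {x, shift s x})"
      using gi col_le by auto
  qed
  ultimately show ?thesis by blast
qed

section \<open>Ternary Toeplitz points\<close>

text \<open>Selects one vector from each pair \<open>w\<close>, \<open>- w\<close> of nonzero
  vectors modulo 3. The coordinate chosen by \<open>SOME\<close> depends only on which coordinates
  are divisible by 3, hence agrees for \<open>w\<close> and \<open>- w\<close>.\<close>

definition ternary_sign :: "int ^ 'n \<Rightarrow> bool" where
  "ternary_sign w \<longleftrightarrow> w $ (SOME i. \<not> 3 dvd w $ i) mod 3 = 1"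

lemma ternary_sign_cong:
  assumes "\<And>i. w' $ i mod 3 = w $ i mod 3"
  shows "ternary_sign w' = ternary_sign w"
proof -
  have "(\<lambda>i. \<not> 3 dvd w' $ i) = (\<lambda>i. \<not> 3 dvd w $ i)"
    by (rule ext) (simp only: dvd_eq_mod_eq_0 assms)
  then show ?thesis unfolding ternary_sign_def by (simp only: assms)
qed

text \<open>Doubling is negation modulo 3: it keeps the inspected coordinate and swaps the residues
  1 and 2 there.\<close>

lemma ternary_sign_double:
  assumes double: "\<And>i. w' $ i mod 3 = (2 * w $ i) mod 3" and nz: "\<not> (\<forall>i. 3 dvd w $ i)"
  shows "ternary_sign w' \<longleftrightarrow> \<not> ternary_sign w"
proof -
  have dvd_iff: "3 dvd w' $ i \<longleftrightarrow> 3 dvd w $ i" for i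
    using double[of i] by presburger
  define k where "k = (SOME i. \<not> 3 dvd w $ i)"
  have k: "\<not> 3 dvd w $ k" unfolding k_def by (rule someI_ex) (use nz in blast)
  have "(SOME i. \<not> 3 dvd w' $ i) = k" unfolding k_def dvd_iff ..
  then have "ternary_sign w' \<longleftrightarrow> w' $ k mod 3 = 1" by (simp add: ternary_sign_def)
  moreover have "ternary_sign w \<longleftrightarrow> w $ k mod 3 = 1" by (simp add: ternary_sign_def k_def)
  ultimately show ?thesis using k double[of k] by presburger
qed

text \<open>
  The value at \<open>h\<close> is the sign of the last nonzero ternary digit vector of \<open>h\<close>, provided that its
  position lies in \<open>J\<close>.
\<close>

definition toeplitz :: "nat set \<Rightarrow> int ^ 'n \<Rightarrow> bool" where
  "toeplitz J h \<longleftrightarrow>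
     (\<exists>v\<in>J. \<exists>w. (\<forall>i. h $ i = 3 ^ v * w $ i) \<and> \<not> (\<forall>i. 3 dvd w $ i) \<and> ternary_sign w)"

section \<open>Periods and uniform aperiodicity of the Toeplitz points\<close>

lemma ternary_scale_unique:
  fixes w w' :: "int ^ 'n"
  assumes "\<And>i. 3 ^ v * w $ i = 3 ^ v' * w' $ i" and "\<not> (\<forall>i. 3 dvd w $ i)" "\<not> (\<forall>i. 3 dvd w' $ i)"
  shows "v = v' \<and> w = w'"
proof -
  have not_less: "\<not> a < b"
    if eq: "\<And>i. 3 ^ a * u $ i = 3 ^ b * u' $ i" and nz: "\<not> (\<forall>i. 3 dvd u $ i)"
    for a b :: nat and u u' :: "int ^ 'n"
  proof
    assume "a < b"
    then obtain d where b: "b = a + Suc d" using less_imp_Suc_add by fastforce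
    have "u $ i = 3 * (3 ^ d * u' $ i)" for i
    proof -
      have "3 ^ a * u $ i = 3 ^ a * (3 * (3 ^ d * u' $ i))"
        using eq[of i] by (simp add: b power_add ac_simps)
      then show ?thesis by simp
    qed
    then have "\<forall>i. 3 dvd u $ i" by (metis dvd_triv_left)
    then show False using nz by blast
  qed
  have "v = v'"
    using not_less[of v w v' w'] not_less[of v' w' v w] assms by (metis linorder_neqE_nat)
  then show ?thesis using assms(1) by (simp add: vec_eq_iff)
qed

lemma toeplitz_scaled:
  assumes "v \<in> J" "\<And>i. h $ i = 3 ^ v * w $ i" "\<not> (\<forall>i. 3 dvd w $ i)"
  shows "toeplitz J h = ternary_sign w"
proof
  assume "toeplitz J h"
  then obtain v' w' where w': "\<forall>i. h $ i = 3 ^ v' * w' $ i" "\<not> (\<forall>i. 3 dvd w' $ i)" "ternary_sign w'"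
    unfolding toeplitz_def by blast
  have "v = v' \<and> w = w'"
    by (rule ternary_scale_unique) (use assms w' in simp_all)
  then show "ternary_sign w" using w'(3) by simp
next
  assume "ternary_sign w"
  then show "toeplitz J h" using assms unfolding toeplitz_def by blast
qed

text \<open>At a level \<open>v < j\<close>, adding a multiple of \<open>3 ^ j\<close> changes the
  cofactor \<open>w\<close> by a multiple of 3, which affects neither its sign nor its
  divisibility.\<close>

lemma toeplitz_periodic:
  assumes m: "\<And>i. 3 ^ j dvd m $ i"
  shows "toeplitz {..<j} (h + m) = toeplitz {..<j} h"
proof -
  have *: "toeplitz {..<j} (h + m)" if "toeplitz {..<j} h" and m: "\<And>i. 3 ^ j dvd m $ i"
    for h m :: "int ^ 'a"
  proof -
    from that(1) obtain v w where v: "v < j" and h: "\<forall>i. h $ i = 3 ^ v * w $ i"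
      and nz: "\<not> (\<forall>i. 3 dvd w $ i)" and sign: "ternary_sign w"
      unfolding toeplitz_def by blast
    define c :: "int ^ 'a" where "c = (\<chi> i. m $ i div 3 ^ Suc v)"
    define w' where "w' = (\<chi> i. w $ i + 3 * c $ i)"
    have "(3::int) ^ Suc v dvd 3 ^ j" using v by (intro le_imp_power_dvd) simp
    then have c: "m $ i = 3 ^ Suc v * c $ i" for i
      using dvd_trans[OF _ m[of i]] by (simp add: c_def del: power_Suc)
    have "toeplitz {..<j} (h + m) = ternary_sign w'"
    proof (rule toeplitz_scaled)
      show "v \<in> {..<j}" using v by simp
      show "(h + m) $ i = 3 ^ v * w' $ i" for i
        using h c[of i] by (simp add: w'_def algebra_simps)
      show "\<not> (\<forall>i. 3 dvd w' $ i)" using nz by (simp add: w'_def dvd_add_left_iff)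
    qed
    also have "\<dots> = ternary_sign w" by (rule ternary_sign_cong) (simp add: w'_def)
    finally show ?thesis using sign by simp
  qed
  have "toeplitz {..<j} h" if "toeplitz {..<j} (h + m)"
    using *[OF that, of "- m"] m by simp
  then show ?thesis using *[of h m] m by blast
qed

text \<open>With \<open>s = 3 ^ v * u\<close> and \<open>u\<close> not divisible by 3, every
  \<open>g\<close> has a bounded \<open>t\<close> with \<open>g + t\<close> congruent to
  \<open>s\<close> modulo \<open>3 ^ Suc v\<close>. Then \<open>g + t\<close> and
  \<open>g + t + s\<close> have cofactors congruent to \<open>u\<close> and \<open>2 * u\<close>
  modulo 3, of opposite sign. \<open>v\<close> and \<open>T\<close> depend on \<open>s\<close>
  alone, and this uniformity in \<open>J\<close> and \<open>g\<close> is what passes to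
  limits.\<close>

lemma toeplitz_aperiodic:
  fixes s :: "int ^ 'n"
  assumes "s \<noteq> 0"
  shows "\<exists>v T. finite T \<and>
    (\<forall>J. v \<in> J \<longrightarrow> (\<forall>g. \<exists>t\<in>T. toeplitz J (g + t) \<noteq> toeplitz J (g + t + s)))"
proof -
  \<comment> \<open>\<open>Q\<close> serves to find the largest \<open>v\<close> with
    \<open>3 ^ v\<close> dividing all coordinates of \<open>s\<close>; divisibility has failed by
    the exponent \<open>\<bar>s $ k\<bar>\<close>, since \<open>3 ^ a > a\<close>.\<close>
  define Q where "Q v \<longleftrightarrow> \<not> (\<forall>i. 3 ^ v dvd s $ i)" for v
  obtain k where k: "s $ k \<noteq> 0" using assms by (auto simp: vec_eq_iff)
  have "Q (nat \<bar>s $ k\<bar>)"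
  proof -
    have "nat \<bar>s $ k\<bar> < 3 ^ nat \<bar>s $ k\<bar>" by (rule power_gt_expt) simp
    then have "\<bar>s $ k\<bar> < 3 ^ nat \<bar>s $ k\<bar>" by (simp add: nat_less_iff)
    then have "\<not> 3 ^ nat \<bar>s $ k\<bar> dvd s $ k" using k zdvd_imp_le[of "3 ^ nat \<bar>s $ k\<bar>" "\<bar>s $ k\<bar>"] by auto
    then show ?thesis unfolding Q_def by blast
  qed
  moreover have "\<not> Q 0" by (simp add: Q_def)
  ultimately obtain v where v: "\<not> Q v" "Q (Suc v)"
    by (metis inc_induct[of 0 _ "\<lambda>v. Q v"] le0)
  define u :: "int ^ 'n" where "u = (\<chi> i. s $ i div 3 ^ v)"
  have u: "s $ i = 3 ^ v * u $ i" for i using v(1) by (simp add: Q_def u_def)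
  have u_nz: "\<not> (\<forall>i. 3 dvd u $ i)"
  proof
    assume "\<forall>i. 3 dvd u $ i"
    then have "3 ^ Suc v dvd s $ i" for i unfolding u power_Suc2 by (intro mult_dvd_mono) simp_all
    then show False using v(2) by (simp add: Q_def)
  qed
  define N :: int where "N = 3 ^ Suc v"
  have N: "N > 0" "N = 3 ^ v * 3" by (simp_all add: N_def)
  show ?thesis
  proof (intro exI[of _ v] exI[of _ "box N"] conjI allI impI)
    show "finite (box N :: (int ^ 'n) set)" by (rule finite_box)
    fix J and g :: "int ^ 'n" assume J: "v \<in> J"
    define t :: "int ^ 'n" where "t = (\<chi> i. (s $ i - g $ i) mod N)"
    define c :: "int ^ 'n" where "c = (\<chi> i. - ((s $ i - g $ i) div N))"
    have gt: "(g + t) $ i = s $ i + N * c $ i" for i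
      unfolding t_def c_def vec_lambda_beta vector_add_component
      using mult_div_mod_eq[of N "s $ i - g $ i"] by linarith
    have "toeplitz J (g + t) = ternary_sign (\<chi> i. u $ i + 3 * c $ i)"
    proof (rule toeplitz_scaled[OF J])
      show "(g + t) $ i = 3 ^ v * (\<chi> i. u $ i + 3 * c $ i) $ i" for i
        unfolding gt u N(2) by (simp add: algebra_simps)
      show "\<not> (\<forall>i. 3 dvd (\<chi> i. u $ i + 3 * c $ i) $ i)" using u_nz by (simp add: dvd_add_left_iff)
    qed
    also have "\<dots> = ternary_sign u" by (rule ternary_sign_cong) simp
    finally have 1: "toeplitz J (g + t) = ternary_sign u" .
    have "toeplitz J (g + t + s) = ternary_sign (\<chi> i. 2 * u $ i + 3 * c $ i)"
    proof (rule toeplitz_scaled[OF J])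
      show "(g + t + s) $ i = 3 ^ v * (\<chi> i. 2 * u $ i + 3 * c $ i) $ i" for i
        unfolding vector_add_component[of "g + t"] gt u N(2) by (simp add: algebra_simps)
      have "3 dvd 2 * u $ i + 3 * c $ i \<Longrightarrow> 3 dvd u $ i" for i by presburger
      then show "\<not> (\<forall>i. 3 dvd (\<chi> i. 2 * u $ i + 3 * c $ i) $ i)" using u_nz by auto
    qed
    also have "\<dots> \<longleftrightarrow> \<not> ternary_sign u" by (rule ternary_sign_double) (simp_all add: u_nz)
    finally have "toeplitz J (g + t + s) \<longleftrightarrow> \<not> ternary_sign u" .
    moreover have "t \<in> box N"
      using N(1) pos_mod_sign[OF N(1)] pos_mod_bound[OF N(1)] by (auto simp: box_def t_def less_imp_le)
    ultimately show "\<exists>t\<in>box N. toeplitz J (g + t) \<noteq> toeplitz J (g + t + s)" using 1 by blast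
  qed
qed

lemma infinite_int_vec: "infinite (UNIV :: (int ^ 'n::finite) set)"
proof
  assume "finite (UNIV :: (int ^ 'n) set)"
  then have "finite (range (axis undefined :: int \<Rightarrow> int ^ 'n))" by (rule finite_subset[rotated]) simp
  moreover have "inj (axis undefined :: int \<Rightarrow> int ^ 'n)" by (simp add: inj_on_def axis_eq_axis)
  ultimately have "finite (UNIV :: int set)" by (rule finite_imageD)
  then show False by simp
qed

text \<open>Overwriting the aperiodic point \<open>toeplitz UNIV\<close> on a finite set keeps it
  free: each \<open>s\<close> is refuted as a period near every \<open>g\<close>, in particular far
  away from \<open>W\<close>.\<close>

lemma free_part_dense:
  fixes z :: "int ^ 'n::finite \<Rightarrow> bool"
  assumes W: "finite W"
  shows "\<exists>y\<in>free_part. \<forall>h\<in>W. y h = z h"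
proof -
  define y where "y h = (if h \<in> W then z h else toeplitz UNIV h)" for h
  have "shift s y \<noteq> y" if s: "s \<noteq> 0" for s
  proof
    assume eq: "shift s y = y"
    from toeplitz_aperiodic[OF s] obtain v T where T: "finite T"
      "\<forall>J. v \<in> J \<longrightarrow> (\<forall>g. \<exists>t\<in>T. toeplitz J (g + t) \<noteq> toeplitz J (g + t + s))"
      by (elim exE conjE)
    \<comment> \<open>The base points \<open>g\<close> for which some tested place
      \<open>g + t\<close> or \<open>g + t + s\<close> falls into \<open>W\<close>.\<close>
    define B where "B = (\<lambda>(w, t). w - t) ` (W \<times> T) \<union> (\<lambda>(w, t). w - s - t) ` (W \<times> T)"
    have "finite B" using W T(1) by (simp add: B_def)
    then obtain g where g: "g \<notin> B" using ex_new_if_finite infinite_int_vec by blast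
    obtain t where t: "t \<in> T" "toeplitz UNIV (g + t) \<noteq> toeplitz UNIV (g + t + s)"
      using T(2) by blast
    have "g + t \<notin> W"
    proof
      assume "g + t \<in> W"
      then have "g \<in> (\<lambda>(w, t). w - t) ` (W \<times> T)" using t(1) by (intro image_eqI[of _ _ "(g + t, t)"]) auto
      then show False using g by (simp add: B_def)
    qed
    moreover have "g + t + s \<notin> W"
    proof
      assume "g + t + s \<in> W"
      then have "g \<in> (\<lambda>(w, t). w - s - t) ` (W \<times> T)"
        using t(1) by (intro image_eqI[of _ _ "(g + t + s, t)"]) auto
      then show False using g by (simp add: B_def)
    qed
    ultimately have "y (g + t) \<noteq> y (g + t + s)" using t(2) by (simp add: y_def)
    moreover have "shift s y (g + t) = y (g + t)" by (simp only: eq)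
    ultimately show False by (simp add: shift_def)
  qed
  then have "y \<in> free_part" by (simp add: free_part_def)
  moreover have "\<forall>h\<in>W. y h = z h" by (simp add: y_def)
  ultimately show ?thesis by blast
qed

section \<open>No continuous perfect matching\<close>

lemma even_card_involution:
  assumes "finite T" "\<And>x. x \<in> T \<Longrightarrow> f x \<in> T" "\<And>x. x \<in> T \<Longrightarrow> f (f x) = x" "\<And>x. x \<in> T \<Longrightarrow> f x \<noteq> x"
  shows "even (card T)"
  using assms
proof (induction T rule: finite_psubset_induct)
  case (psubset T)
  show ?case
  proof (cases "T = {}")
    case False
    then obtain x where x: "x \<in> T" by blast
    define T' where "T' = T - {x, f x}"
    have fx: "f x \<in> T" "f x \<noteq> x" using psubset.prems x by blast+
    have "even (card T')"
    proof (rule psubset.IH)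
      show "T' \<subset> T" using x by (auto simp: T'_def)
      show "f y \<in> T'" if y: "y \<in> T'" for y
      proof -
        have "f (f y) = y" "f y \<in> T" "f (f x) = x" using y x psubset.prems by (simp_all add: T'_def)
        moreover have "y \<noteq> x" "y \<noteq> f x" using y by (simp_all add: T'_def)
        ultimately show ?thesis unfolding T'_def by (metis DiffI insertE singletonD)
      qed
    qed (use psubset.prems in \<open>auto simp: T'_def\<close>)
    moreover have "card T = card T' + 2"
    proof -
      have "card {x, f x} = 2" using fx(2) by simp
      moreover have "card T' = card T - card {x, f x}"
        unfolding T'_def using x fx(1) by (intro card_Diff_subset) auto
      moreover have "card {x, f x} \<le> card T" using x fx(1) psubset.hyps by (intro card_mono) auto
      ultimately show ?thesis by simp
    qed
    ultimately show ?thesis by simp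
  qed simp
qed

lemma card_int_cube: "card {h :: int ^ 'n. \<forall>i. 0 \<le> h $ i \<and> h $ i < int p} = p ^ CARD('n)"
proof -
  have "{h :: int ^ 'n. \<forall>i. 0 \<le> h $ i \<and> h $ i < int p} = vec_lambda ` (UNIV \<rightarrow>\<^sub>E {0..<int p})"
  proof (intro equalityI subsetI)
    fix h :: "int ^ 'n" assume "h \<in> {h. \<forall>i. 0 \<le> h $ i \<and> h $ i < int p}"
    then have "vec_nth h \<in> UNIV \<rightarrow>\<^sub>E {0..<int p}" by auto
    then show "h \<in> vec_lambda ` (UNIV \<rightarrow>\<^sub>E {0..<int p})" by (intro image_eqI[of _ _ "vec_nth h"]) simp_all
  qed auto
  moreover have "inj_on (vec_lambda :: ('n \<Rightarrow> int) \<Rightarrow> int ^ 'n) X" for X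
    by (rule inj_onI) (simp add: vec_lambda_inject)
  ultimately show ?thesis by (simp add: card_image card_PiE)
qed

lemma compact_bool_functions: "compact (UNIV :: ('i \<Rightarrow> bool) set)"
proof -
  have "compact_space (euclidean :: bool topology)"
    by (simp add: compact_space_def finite_imp_compact)
  then have "compact_space (product_topology (\<lambda>_ :: 'i. euclidean :: bool topology) UNIV)"
    by (simp add: compact_space_product_topology)
  then show ?thesis by (simp add: euclidean_product_topology compact_space_def)
qed

lemma std_generators_uminus: "s \<in> std_generators \<Longrightarrow> - s \<in> std_generators"
  by (auto simp: std_generators_def)

text \<open>\<open>\<sigma> h\<close> points from \<open>h\<close> to its partner. By periodicity
  the matching descends to the torus of side \<open>p\<close>, represented by \<open>T\<close>.
  There it is an involution, without fixed points because a unit step is nonzero modulo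
  \<open>p > 1\<close>; but \<open>T\<close> has an odd number \<open>p ^ CARD('n)\<close> of
  elements.\<close>

lemma locally_periodic_matching_impossible:
  fixes \<sigma> :: "int ^ 'n::finite \<Rightarrow> int ^ 'n" and p :: nat
  assumes p: "odd p" "p > 1"
    and gen: "\<And>h. \<sigma> h \<in> std_generators"
    and reverse: "\<And>h. \<sigma> (\<sigma> h + h) = - \<sigma> h"
    and per: "\<And>h m. (\<And>i. int p dvd m $ i) \<Longrightarrow> \<sigma> (h + m) = \<sigma> h"
  shows False
proof -
  define T where "T = {h :: int ^ 'n. \<forall>i. 0 \<le> h $ i \<and> h $ i < int p}"
  define red :: "int ^ 'n \<Rightarrow> int ^ 'n" where "red h = (\<chi> i. h $ i mod int p)" for h
  define f where "f h = red (\<sigma> h + h)" for h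
  have red_T: "red h \<in> T" for h using p by (simp add: red_def T_def)
  have red_id: "red h = h" if "h \<in> T" for h
    using that by (simp add: red_def T_def vec_eq_iff)
  have \<sigma>_red: "\<sigma> (red h) = \<sigma> h" for h
  proof -
    have "\<sigma> (red h + (h - red h)) = \<sigma> (red h)"
      by (rule per) (simp add: red_def minus_mod_eq_mult_div)
    then show ?thesis by simp
  qed
  have red_add: "red (a + red b) = red (a + b)" for a b
    by (simp add: red_def vec_eq_iff mod_add_right_eq)
  have "finite T"
  proof (rule finite_subset)
    show "T \<subseteq> box (int p)" by (auto simp: T_def box_def less_imp_le)
  qed (rule finite_box)
  then have "even (card T)"
  proof (rule even_card_involution)
    show "f h \<in> T" for h unfolding f_def by (rule red_T)
    show "f (f h) = h" if h: "h \<in> T" for h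
    proof -
      have "f (f h) = red (- \<sigma> h + red (\<sigma> h + h))"
        unfolding f_def \<sigma>_red reverse ..
      also have "\<dots> = red h" unfolding red_add by simp
      finally show ?thesis using red_id[OF h] by simp
    qed
    show "f h \<noteq> h" if "h \<in> T" for h
    proof
      assume eq: "f h = h"
      from gen[of h] obtain i where "\<sigma> h = axis i 1 \<or> \<sigma> h = - axis i 1"
        by (auto simp: std_generators_def)
      then have i: "\<bar>\<sigma> h $ i\<bar> = 1" by auto
      have "(\<sigma> h $ i + h $ i) mod int p = h $ i mod int p"
      proof -
        have "(\<sigma> h $ i + h $ i) mod int p = f h $ i" by (simp add: f_def red_def)
        also have "\<dots> = red h $ i" unfolding eq red_id[OF that] ..
        finally show ?thesis by (simp add: red_def)
      qed
      then have "int p dvd (\<sigma> h $ i + h $ i) - h $ i" by (simp only: mod_eq_dvd_iff)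
      then have "int p dvd \<bar>\<sigma> h $ i\<bar>" by simp
      then show False unfolding i using p(2) by simp
    qed
  qed
  then show False using p by (simp add: T_def card_int_cube)
qed

text \<open>
  The predicate \<open>ev s z\<close> of the proof extends \<open>m s\<close> from the free part to the open set \<open>G\<close> of all
  points near which the matched generator is constant; density of the free part makes it unique.
\<close>

lemma no_continuous_perfect_matching:
  fixes m :: "int ^ 'n::finite \<Rightarrow> (int ^ 'n \<Rightarrow> bool) \<Rightarrow> bool"
  assumes loc: "\<And>s. s \<in> std_generators \<Longrightarrow> locally_determined free_part (m s)"
    and ex: "\<And>x. x \<in> free_part \<Longrightarrow> \<exists>s\<in>std_generators. m s x"
    and unique: "\<And>x s s'. x \<in> free_part \<Longrightarrow> s \<in> std_generators \<Longrightarrow> s' \<in> std_generators \<Longrightarrow>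
      m s x \<Longrightarrow> m s' x \<Longrightarrow> s = s'"
    and sym: "\<And>x s. x \<in> free_part \<Longrightarrow> s \<in> std_generators \<Longrightarrow> m s x \<Longrightarrow> m (- s) (shift s x)"
  shows False
proof -
  define ev where "ev s z \<longleftrightarrow> (\<exists>W. finite W \<and> (\<forall>y\<in>free_part. (\<forall>h\<in>W. y h = z h) \<longrightarrow> m s y))" for s z
  define G where "G = {z. \<exists>s\<in>std_generators. ev s z}"
  have ev_unique: "s = s'"
    if s: "s \<in> std_generators" "s' \<in> std_generators" and evs: "ev s z" "ev s' z" for s s' z
  proof -
    from evs(1) obtain W where W: "finite W" "\<forall>y\<in>free_part. (\<forall>h\<in>W. y h = z h) \<longrightarrow> m s y"
      unfolding ev_def by blast
    from evs(2) obtain W' where W': "finite W'" "\<forall>y\<in>free_part. (\<forall>h\<in>W'. y h = z h) \<longrightarrow> m s' y"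
      unfolding ev_def by blast
    have "finite (W \<union> W')" using W(1) W'(1) by simp
    from free_part_dense[OF this, of z] obtain y where
      y: "y \<in> free_part" "\<forall>h\<in>W \<union> W'. y h = z h" by blast
    have "m s y" "m s' y" using W(2) W'(2) y by blast+
    then show ?thesis using unique[OF y(1) s] by blast
  qed
  have ev_step: "ev (- s) (shift s z)" if s: "s \<in> std_generators" and evs: "ev s z" for s z
  proof -
    from evs obtain W where W: "finite W" "\<forall>y\<in>free_part. (\<forall>h\<in>W. y h = z h) \<longrightarrow> m s y"
      unfolding ev_def by blast
    have "m (- s) y" if y: "y \<in> free_part" "\<forall>h\<in>(\<lambda>h. h - s) ` W. y h = shift s z h" for y
    proof -
      have "shift (- s) y \<in> free_part" using y(1) by simp
      moreover have "\<forall>h\<in>W. shift (- s) y h = z h" using y(2) by (simp add: shift_def)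
      ultimately have "m s (shift (- s) y)" using W(2) by blast
      from sym[OF _ s this] y(1) show ?thesis by simp
    qed
    then show ?thesis unfolding ev_def using W(1) by (intro exI[of _ "(\<lambda>h. h - s) ` W"]) blast
  qed
  have free_G: "free_part \<subseteq> G"
  proof
    fix x :: "int ^ 'n \<Rightarrow> bool" assume x: "x \<in> free_part"
    from ex[OF x] obtain s where s: "s \<in> std_generators" "m s x" by blast
    obtain W where "finite W" "\<forall>y\<in>free_part. (\<forall>h\<in>W. y h = x h) \<longrightarrow> m s y = m s x"
      using locally_determinedD[OF loc[OF s(1)] x] by blast
    then have "ev s x" using s(2) unfolding ev_def by blast
    then show "x \<in> G" using s(1) unfolding G_def by blast
  qed
  \<comment> \<open>A window that certifies \<open>z\<close> certifies every point of its
    cylinder.\<close>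
  have open_G: "open G"
    unfolding open_subopen[of G]
  proof
    fix z assume "z \<in> G"
    then obtain s W where s: "s \<in> std_generators" and W: "finite W"
      "\<forall>y\<in>free_part. (\<forall>h\<in>W. y h = z h) \<longrightarrow> m s y"
      unfolding G_def ev_def by blast
    have "{y. \<forall>h\<in>W. y h = z h} \<subseteq> G"
    proof
      fix y assume y: "y \<in> {y. \<forall>h\<in>W. y h = z h}"
      have "m s y'" if y': "y' \<in> free_part" "\<forall>h\<in>W. y' h = y h" for y'
      proof -
        have "\<forall>h\<in>W. y' h = z h" using y y'(2) by simp
        then show ?thesis using W(2) y'(1) by blast
      qed
      then have "ev s y" unfolding ev_def using W(1) by blast
      then show "y \<in> G" using s unfolding G_def by blast
    qed
    moreover have "z \<in> {y. \<forall>h\<in>W. y h = z h}" by simp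
    ultimately show "\<exists>T. open T \<and> z \<in> T \<and> T \<subseteq> G" using open_cylinder[OF W(1), of z] by blast
  qed
  \<comment> \<open>\<open>q s\<close> fixes a level and a finite test set for each nonzero
    \<open>s\<close>, so that the sets \<open>Y s\<close> below are closed conditions with finite
    tests.\<close>
  define wit where "wit s p \<longleftrightarrow> finite (snd p) \<and> (\<forall>J. fst p \<in> J \<longrightarrow>
      (\<forall>g. \<exists>t\<in>snd p. toeplitz J (g + t) \<noteq> toeplitz J (g + t + s)))"
    for s :: "int ^ 'n" and p :: "nat \<times> (int ^ 'n) set"
  define q where "q s = (SOME p. wit s p)" for s
  have q: "wit s (q s)" if "s \<noteq> 0" for s
  proof -
    from toeplitz_aperiodic[OF that] obtain v T where "finite T \<and>
        (\<forall>J. v \<in> J \<longrightarrow> (\<forall>g. \<exists>t\<in>T. toeplitz J (g + t) \<noteq> toeplitz J (g + t + s)))"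
      by (elim exE)
    then have "wit s (v, T)" by (simp add: wit_def)
    then show ?thesis unfolding q_def by (rule someI)
  qed
  define Y where "Y s = {z :: int ^ 'n \<Rightarrow> bool. \<forall>g. \<exists>t\<in>snd (q s). z (g + t) \<noteq> z (g + t + s)}" for s
  have closed_Y: "closed (Y s)" if s: "s \<noteq> 0" for s
  proof -
    have "open {z :: int ^ 'n \<Rightarrow> bool. z a = z b}" for a b
    proof -
      have "{z :: int ^ 'n \<Rightarrow> bool. z a = z b} =
          ({z. z a = True} \<inter> {z. z b = True}) \<union> ({z. z a = False} \<inter> {z. z b = False})" by auto
      then show ?thesis by (simp only: open_Un open_Int open_coordinate)
    qed
    then have "closed {z :: int ^ 'n \<Rightarrow> bool. z a \<noteq> z b}" for a b
      by (simp add: closed_def Compl_eq)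
    then have "closed (\<Inter>g. \<Union>t\<in>snd (q s). {z :: int ^ 'n \<Rightarrow> bool. z (g + t) \<noteq> z (g + t + s)})"
      using q[OF s] unfolding wit_def by (intro closed_INT closed_UN ballI) auto
    moreover have "Y s = (\<Inter>g. \<Union>t\<in>snd (q s). {z. z (g + t) \<noteq> z (g + t + s)})"
      unfolding Y_def by auto
    ultimately show ?thesis by simp
  qed
  have Y_free: "z \<in> free_part" if z: "\<And>s. s \<noteq> 0 \<Longrightarrow> z \<in> Y s" for z
    unfolding free_part_def
  proof (intro CollectI allI impI notI)
    fix s assume s: "s \<noteq> 0" and eq: "shift s z = z"
    obtain t where "z (0 + t) \<noteq> z (0 + t + s)" using z[OF s] unfolding Y_def by blast
    moreover have "shift s z (0 + t) = z (0 + t)" by (simp only: eq)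
    ultimately show False by (simp add: shift_def)
  qed
  \<comment> \<open>Compactness: if for each \<open>j \<ge> 1\<close> some translate left
    \<open>G\<close>, these translates would show that the closed sets \<open>Y s\<close> have the
    finite intersection property on the compact set \<open>- G\<close>. A common point would be
    free, yet outside \<open>G\<close>. The bound \<open>j \<ge> 1\<close> is there to make the side
    \<open>3 ^ j\<close> of the torus exceed 1.\<close>
  have "\<exists>j\<ge>1. \<forall>h. shift h (toeplitz {..<j}) \<in> G"
  proof (rule ccontr)
    assume neg: "\<not> ?thesis"
    have "- G \<inter> (\<Inter>s\<in>{s. s \<noteq> 0}. Y s) \<noteq> {}"
    proof (rule compact_imp_fip_image)
      show "compact (- G)"
        using compact_Int_closed[OF compact_bool_functions, of "- G"] open_G by (simp add: closed_def)
      show "closed (Y s)" if "s \<in> {s. s \<noteq> 0}" for s using closed_Y that by simp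
      fix I :: "(int ^ 'n) set" assume I: "finite I" "I \<subseteq> {s. s \<noteq> 0}"
      \<comment> \<open>Beyond every level tested by \<open>I\<close>, so one Toeplitz point passes
        all these tests; \<open>insert 0\<close> keeps \<open>Max\<close> meaningful for empty
        \<open>I\<close>.\<close>
      define j where "j = Suc (Max (insert 0 ((\<lambda>s. fst (q s)) ` I)))"
      have j: "fst (q s) < j" if "s \<in> I" for s
        unfolding j_def using I(1) that by (intro le_imp_less_Suc Max_ge) auto
      have "1 \<le> j" by (simp add: j_def)
      then obtain h where h: "shift h (toeplitz {..<j}) \<notin> G" using neg by blast
      have "shift h (toeplitz {..<j}) \<in> Y s" if s: "s \<in> I" for s
        unfolding Y_def
      proof (intro CollectI allI)
        fix g
        have "s \<noteq> 0" using s I(2) by blast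
        then have "\<exists>t\<in>snd (q s). toeplitz {..<j} (h + g + t) \<noteq> toeplitz {..<j} (h + g + t + s)"
          using q[of s] j[OF s] unfolding wit_def by simp
        then show "\<exists>t\<in>snd (q s). shift h (toeplitz {..<j}) (g + t) \<noteq> shift h (toeplitz {..<j}) (g + t + s)"
          unfolding shift_def by (simp add: ac_simps)
      qed
      then show "- G \<inter> (\<Inter>s\<in>I. Y s) \<noteq> {}" using h by blast
    qed
    then obtain z where "z \<notin> G" "\<forall>s. s \<noteq> 0 \<longrightarrow> z \<in> Y s" by auto
    then show False using Y_free free_G by blast
  qed
  then obtain j where j: "1 \<le> j" and G: "\<And>h. shift h (toeplitz {..<j}) \<in> G" by blast
  define \<sigma> where "\<sigma> h = (SOME s. s \<in> std_generators \<and> ev s (shift h (toeplitz {..<j})))" for h :: "int ^ 'n"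
  have \<sigma>: "\<sigma> h \<in> std_generators \<and> ev (\<sigma> h) (shift h (toeplitz {..<j}))" for h
    unfolding \<sigma>_def by (rule someI_ex) (use G[of h] in \<open>auto simp: G_def\<close>)
  show False
  proof (rule locally_periodic_matching_impossible[of "3 ^ j" \<sigma>])
    show "odd (3 ^ j :: nat)" by simp
    show "1 < (3 ^ j :: nat)" using j by (intro one_less_power) simp_all
    show "\<sigma> h \<in> std_generators" for h using \<sigma> by blast
    show "\<sigma> (\<sigma> h + h) = - \<sigma> h" for h
    proof (rule ev_unique)
      show "- \<sigma> h \<in> std_generators" using \<sigma> std_generators_uminus by blast
      show "ev (\<sigma> (\<sigma> h + h)) (shift (\<sigma> h + h) (toeplitz {..<j}))" using \<sigma> by blast
      have "ev (- \<sigma> h) (shift (\<sigma> h) (shift h (toeplitz {..<j})))" using \<sigma> ev_step by blast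
      then show "ev (- \<sigma> h) (shift (\<sigma> h + h) (toeplitz {..<j}))" by simp
    qed (use \<sigma> in blast)
    \<comment> \<open>The translates by \<open>h\<close> and \<open>h + m\<close> are the same
      point, so \<open>SOME\<close> makes the same choice for both.\<close>
    show "\<sigma> (h + m) = \<sigma> h" if m: "\<And>i. int (3 ^ j) dvd m $ i" for h m :: "int ^ 'n"
    proof -
      have "toeplitz {..<j} (k + (h + m)) = toeplitz {..<j} (k + h)" for k
        using toeplitz_periodic[of j m "k + h"] m by (simp add: ac_simps)
      then have "shift (h + m) (toeplitz {..<j}) = shift h (toeplitz {..<j})"
        unfolding shift_def by (simp only:)
      then show ?thesis by (simp only: \<sigma>_def)
    qed
  qed
qed

section \<open>From too few colors to a perfect matching\<close>

lemma card_std_generators: "card (std_generators :: (int ^ 'n::finite) set) = 2 * CARD('n)"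
proof -
  have "card (range (\<lambda>i :: 'n. axis i (1 :: int))) = CARD('n)"
    by (rule card_image) (simp add: inj_on_def axis_eq_axis)
  moreover have "card (range (\<lambda>i :: 'n. - axis i (1 :: int))) = CARD('n)"
    by (rule card_image) (simp add: inj_on_def axis_eq_axis)
  moreover have "axis i (1 :: int) \<noteq> - axis j 1" for i j :: 'n
    by (simp add: axis_uminus axis_eq_axis)
  then have "range (\<lambda>i :: 'n. axis i (1 :: int)) \<inter> range (\<lambda>i. - axis i 1) = {}" by blast
  ultimately show ?thesis unfolding std_generators_def by (simp add: card_Un_disjoint)
qed

text \<open>By freeness each vertex has \<open>2 * CARD('n)\<close> distinct edges, so with at most
  that many colors it sees every color exactly once. The edges of a single color then form a
  continuous perfect matching.\<close>

lemma edge_coloring_needs_extra_color: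
  fixes c :: "(int ^ 'n::finite \<Rightarrow> bool) set \<Rightarrow> 'c"
  assumes K: "finite K"
    and proper: "proper_edge_coloring (schreier_edges free_part std_generators) K c"
    and cont: "continuous_edge_coloring free_part std_generators K c"
  shows "2 * CARD('n) + 1 \<le> card K"
proof (rule ccontr)
  assume "\<not> ?thesis"
  then have card_K: "card K \<le> 2 * CARD('n)" by simp
  let ?S = "std_generators :: (int ^ 'n) set"
  have edge: "{x, shift s x} \<in> schreier_edges free_part std_generators"
    if "x \<in> free_part" "s \<in> ?S" for x s
    unfolding schreier_edges_def using that
    by (intro CollectI exI[of _ x] exI[of _ "shift s x"] conjI bexI[of _ s]) simp_all
  have K_val: "c E \<in> K" if "E \<in> schreier_edges free_part std_generators" for E
    using proper that unfolding proper_edge_coloring_def by (elim conjE subsetD) (rule imageI)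
  have distinct: "c E \<noteq> c E'"
    if "E \<in> schreier_edges free_part std_generators" "E' \<in> schreier_edges free_part std_generators"
      "E \<noteq> E'" "E \<inter> E' \<noteq> {}" for E E'
    using proper that unfolding proper_edge_coloring_def by simp
  have inj: "inj_on (\<lambda>s. c {x, shift s x}) ?S" if x: "x \<in> free_part" for x
  proof (rule inj_onI, rule ccontr)
    fix s s' assume s: "s \<in> ?S" "s' \<in> ?S" and eq: "c {x, shift s x} = c {x, shift s' x}" and ne: "s \<noteq> s'"
    have "shift s x \<noteq> shift s' x" using shift_eq_iff[OF x] ne by blast
    then have "{x, shift s x} \<noteq> {x, shift s' x}" by (auto simp: doubleton_eq_iff)
    then have "c {x, shift s x} \<noteq> c {x, shift s' x}"
      by (intro distinct edge x s) simp_all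
    then show False using eq by simp
  qed
  have onto: "(\<lambda>s. c {x, shift s x}) ` ?S = K" if x: "x \<in> free_part" for x
  proof (rule card_seteq[OF K])
    show "(\<lambda>s. c {x, shift s x}) ` ?S \<subseteq> K"
      by (intro image_subsetI K_val edge x)
    show "card K \<le> card ((\<lambda>s. c {x, shift s x}) ` ?S)"
      using card_K by (simp add: card_image[OF inj[OF x]] card_std_generators)
  qed
  \<comment> \<open>Density with an empty window shows that the free part is nonempty, so there is a
    color to work with.\<close>
  obtain x0 :: "int ^ 'n \<Rightarrow> bool" where x0: "x0 \<in> free_part" using free_part_dense[of "{}"] by blast
  have "K \<noteq> {}" using onto[OF x0] by (auto simp: std_generators_def)
  then obtain a where a: "a \<in> K" by blast
  show False
  proof (rule no_continuous_perfect_matching[of "\<lambda>s x. c {x, shift s x} = a"])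
    show "locally_determined free_part (\<lambda>x. c {x, shift s x} = a)" if "s \<in> ?S" for s
    proof -
      have "locally_determined free_part (\<lambda>x. c {x, shift s x})"
        using cont that unfolding continuous_edge_coloring_def
          continuous_map_discrete_iff_locally_determined by blast
      from locally_determined_app2[OF this locally_determined_const[of _ a], of "(=)"] show ?thesis .
    qed
    show "\<exists>s\<in>?S. c {x, shift s x} = a" if "x \<in> free_part" for x using onto[OF that] a by auto
    show "s = s'" if "x \<in> free_part" "s \<in> ?S" "s' \<in> ?S" "c {x, shift s x} = a" "c {x, shift s' x} = a" for x s s'
      using inj_onD[OF inj[OF that(1)], of s s'] that by simp
    show "c {shift s x, shift (- s) (shift s x)} = a" if "c {x, shift s x} = a" for x s
      using that by (simp add: insert_commute)
  qed
qed

theorem corollary4p8: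
  "continuous_edge_chromatic_number (free_part :: (int ^ 'n::finite \<Rightarrow> bool) set) std_generators
     = enat (2 * CARD('n) + 1)"
  unfolding continuous_edge_chromatic_number_def
proof (rule antisym)
  show "Inf {enat (card K) |K :: nat set. finite K \<and> (\<exists>c. proper_edge_coloring
      (schreier_edges (free_part :: (int ^ 'n \<Rightarrow> bool) set) std_generators) K c \<and>
      continuous_edge_coloring (free_part :: (int ^ 'n \<Rightarrow> bool) set) std_generators K c)}
    \<le> enat (2 * CARD('n) + 1)"
    \<comment> \<open>The color set starts at \<open>0\<close> and so has
      \<open>2 * CARD('n) + 1\<close> elements.\<close>
    by (rule Inf_lower, rule CollectI, rule exI[of _ "{..2 * CARD('n)}"])
      (use edge_coloring_exists in simp)
  show "enat (2 * CARD('n) + 1) \<le> Inf {enat (card K) |K :: nat set. finite K \<and> (\<exists>c.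
      proper_edge_coloring (schreier_edges (free_part :: (int ^ 'n \<Rightarrow> bool) set) std_generators) K c \<and>
      continuous_edge_coloring (free_part :: (int ^ 'n \<Rightarrow> bool) set) std_generators K c)}"
  proof (rule Inf_greatest)
    fix k assume "k \<in> {enat (card K) |K :: nat set. finite K \<and> (\<exists>c.
      proper_edge_coloring (schreier_edges (free_part :: (int ^ 'n \<Rightarrow> bool) set) std_generators) K c \<and>
      continuous_edge_coloring (free_part :: (int ^ 'n \<Rightarrow> bool) set) std_generators K c)}"
    then obtain K :: "nat set" and c where k: "k = enat (card K)" and "finite K"
      "proper_edge_coloring (schreier_edges (free_part :: (int ^ 'n \<Rightarrow> bool) set) std_generators) K c"
      "continuous_edge_coloring (free_part :: (int ^ 'n \<Rightarrow> bool) set) std_generators K c"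
      by (elim CollectE exE conjE)
    then show "enat (2 * CARD('n) + 1) \<le> k" using edge_coloring_needs_extra_color by simp
  qed
qed

end
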